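(* Let $(s,t)=(3,3)$ or $(s,t)=(4,2)$, let $\Sigma$ be a 2-dimensional manifold and let $f:\Sigma\to\mathcal{Z}$ be a Legendre map whose induced conformal structure on $T\Sigma$ has signature $(1,1)$ at every point. Then $f$ is $\mathrm{O}(s,t)$-rigid to third order, i.e. $f$ admits no non-trivial third order $\mathrm{O}(s,t)$-deformation.
   Context: $\mathcal{Z}$ is the Grassmannian of totally null 2-dimensional subspaces of $\mathbb{R}^{s,t}$, acted on by $G=\mathrm{O}(s,t)$. A smooth map $f:\Sigma\to\mathcal{Z}$ is viewed as a rank 2 null subbundle of the trivial bundle $\underline{\mathbb{R}}^{s,t}=\Sigma\times\mathbb{R}^{s,t}$ with trivial connection $d$; $\Gamma$ denotes smooth sections; $f^{(1)}$ is the set of sections of $f$ and derivatives of sections of $f$. $f$ is a Legendre map if $f^{(1)}\le f^{\perp}$ and, whenever $X\in T_{p}\Sigma$ satisfies $d_{X}\sigma\in f(p)$ for all $\sigma\in\Gamma f$, then $X=0$. The induced conformal structure on $T\Sigma$ is the class of the quadratic form $X\mapsto\det(\sigma\mapsto d_{X}\sigma\bmod f)$, where $\sigma\mapsto d_{X}\sigma\bmod f$ is a bundle map $f\to f^{\perp}/f$ between rank 2 bundles (determinant taken with respect to any local trivialisations). $f$ is identified with $F=\wedge^{2}f:\Sigma\to Z\subset\mathbb{P}(\wedge^{2}\mathbb{R}^{s,t})$, where $Z=\{[v\wedge w]: v,w\text{ null},\ v\not\parallel w,\ (v,w)=0\}$, with $\mathrm{O}(s,t)$ acting by $A[v\wedge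 w]=[Av\wedge Aw]$. A map $\hat{f}$ (equivalently $\hat{F}=\wedge^{2}\hat{f}$) is a third order deformation of $f$ if there is a smooth $g:\Sigma\to\mathrm{O}(s,t)$ such that for every $p\in\Sigma$ the maps $g^{-1}(p)\hat{F}$ (with $g^{-1}(p)$ a fixed group element) and $F$ agree to order 3 at $p$ (same 3-jet). It is trivial if $\hat{F}=AF$ for a constant $A\in\mathrm{O}(s,t)$.
   Formalization: The surface Σ is assumed connected; for a disconnected Σ the claim fails, since moving the components by different constant elements of O(s,t) gives a non-trivial third order deformation. *)

theory Defs
  imports "HOL-Analysis.Analysis"
begin

section \<open>Smooth maps and jets on open subsets of normed spaces\<close>

fun Ck_on :: "nat \<Rightarrow> ('a::real_normed_vector \<Rightarrow> 'b::real_normed_vector) \<Rightarrow> 'a set \<Rightarrow> bool" where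
  "Ck_on 0 h U \<longleftrightarrow> continuous_on U h"
| "Ck_on (Suc k) h U \<longleftrightarrow>
     (\<forall>x\<in>U. h differentiable (at x)) \<and>
     (\<forall>v. Ck_on k (\<lambda>x. frechet_derivative h (at x) v) U)"

text \<open>Used only for open \<open>U\<close>.\<close>

definition smooth_on :: "('a::real_normed_vector \<Rightarrow> 'b::real_normed_vector) \<Rightarrow> 'a set \<Rightarrow> bool" where
  "smooth_on h U \<longleftrightarrow> (\<forall>k. Ck_on k h U)"

text \<open>\<open>jet_eq k u v x\<close>: all iterated directional derivatives of \<open>u\<close> and \<open>v\<close> of order at most
  \<open>k\<close> agree at \<open>x\<close>; meaningful for maps that are smooth near \<open>x\<close>.\<close>

fun jet_eq :: "nat \<Rightarrow> ('a::real_normed_vector \<Rightarrow> 'b::real_normed_vector) \<Rightarrow> ('a \<Rightarrow> 'b) \<Rightarrow> 'a \<Rightarrow> bool" where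
  "jet_eq 0 u v x \<longleftrightarrow> u x = v x"
| "jet_eq (Suc k) u v x \<longleftrightarrow> u x = v x \<and>
     (\<forall>\<xi>. jet_eq k (\<lambda>y. frechet_derivative u (at y) \<xi>) (\<lambda>y. frechet_derivative v (at y) \<xi>) x)"


section \<open>Smooth surfaces\<close>

type_synonym 'a chart = "'a set \<times> ('a \<Rightarrow> real^2)"

definition is_chart :: "'a topology \<Rightarrow> 'a chart \<Rightarrow> bool" where
  "is_chart T c \<longleftrightarrow> openin T (fst c) \<and> open (snd c ` fst c) \<and>
     homeomorphic_map (subtopology T (fst c)) (top_of_set (snd c ` fst c)) (snd c)"

text \<open>A map on the surface, written in the coordinates of a chart.\<close>

definition in_chart :: "'a chart \<Rightarrow> ('a \<Rightarrow> 'b) \<Rightarrow> real^2 \<Rightarrow> 'b" where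
  "in_chart c h = h \<circ> inv_into (fst c) (snd c)"

definition smooth_surface :: "'a topology \<Rightarrow> 'a chart set \<Rightarrow> bool" where
  "smooth_surface T A \<longleftrightarrow>
     Hausdorff_space T \<and> second_countable T \<and>
     (\<forall>c\<in>A. is_chart T c) \<and> \<Union>(fst ` A) = topspace T \<and>
     (\<forall>c\<in>A. \<forall>c'\<in>A. smooth_on (in_chart c (snd c')) (snd c ` (fst c \<inter> fst c')))"

definition charts_at :: "'a chart set \<Rightarrow> 'a \<Rightarrow> 'a chart set" where
  "charts_at A p = {c\<in>A. p \<in> fst c}"

definition smooth_fun :: "'a chart set \<Rightarrow> 'a set \<Rightarrow> ('a \<Rightarrow> 'b::real_normed_vector) \<Rightarrow> bool" where
  "smooth_fun A W h \<longleftrightarrow> (\<forall>c\<in>A. smooth_on (in_chart c h) (snd c ` (fst c \<inter> W)))"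

text \<open>A tangent vector \<open>X\<close> at \<open>p\<close> is represented by its coordinate vector \<open>\<xi>\<close> in a chart \<open>c\<close>
  at \<open>p\<close>; \<open>dir_deriv c h p \<xi>\<close> is the derivative of \<open>h\<close> at \<open>p\<close> along \<open>X\<close>. Statements about all
  tangent vectors quantify over all charts at \<open>p\<close> and all coordinate vectors.\<close>

definition dir_deriv :: "'a chart \<Rightarrow> ('a \<Rightarrow> 'b::real_normed_vector) \<Rightarrow> 'a \<Rightarrow> real^2 \<Rightarrow> 'b" where
  "dir_deriv c h p \<xi> = frechet_derivative (in_chart c h) (at (snd c p)) \<xi>"


section \<open>The space \<open>\<real>\<^sup>s\<^sup>,\<^sup>t\<close> and its null planes\<close>

text \<open>\<open>\<real>\<^sup>s\<^sup>,\<^sup>t\<close> is \<open>real^('s + 't)\<close> with \<open>s = CARD('s)\<close> and \<open>t = CARD('t)\<close>.\<close>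

definition ip :: "real^('s::finite + 't::finite) \<Rightarrow> real^('s + 't) \<Rightarrow> real" where
  "ip x y = (\<Sum>i\<in>UNIV. x $ Inl i * y $ Inl i) - (\<Sum>j\<in>UNIV. x $ Inr j * y $ Inr j)"

definition perp :: "(real^('s::finite + 't::finite)) set \<Rightarrow> (real^('s + 't)) set" where
  "perp L = {x. \<forall>y\<in>L. ip x y = 0}"

definition Ogroup :: "(real^('s::finite + 't::finite)^('s + 't)) set" where
  "Ogroup = {M. \<forall>x y. ip (M *v x) (M *v y) = ip x y}"

definition null_planes :: "(real^('s::finite + 't::finite)) set set" where
  "null_planes = {L. subspace L \<and> dim L = 2 \<and> (\<forall>x\<in>L. \<forall>y\<in>L. ip x y = 0)}"


section \<open>Smooth maps into the Grassmannian of null planes\<close>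

text \<open>A smooth map into the Grassmannian, viewed as a rank 2 null subbundle of the trivial bundle:
  smoothness means having smooth local frames.\<close>

definition smooth_null_bundle ::
    "'a topology \<Rightarrow> 'a chart set \<Rightarrow> ('a \<Rightarrow> (real^('s::finite + 't::finite)) set) \<Rightarrow> bool" where
  "smooth_null_bundle T A f \<longleftrightarrow>
     (\<forall>p\<in>topspace T. f p \<in> null_planes) \<and>
     (\<forall>p\<in>topspace T. \<exists>W \<sigma> \<tau>. openin T W \<and> p \<in> W \<and> smooth_fun A W \<sigma> \<and> smooth_fun A W \<tau> \<and>
        (\<forall>q\<in>W. f q = span {\<sigma> q, \<tau> q}))"

definition sections ::
    "'a topology \<Rightarrow> 'a chart set \<Rightarrow> ('a \<Rightarrow> (real^('s::finite + 't::finite)) set)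
      \<Rightarrow> ('a \<Rightarrow> real^('s + 't)) set" where
  "sections T A f = {\<sigma>. smooth_fun A (topspace T) \<sigma> \<and> (\<forall>p\<in>topspace T. \<sigma> p \<in> f p)}"

text \<open>The fibre at \<open>p\<close> of the derived bundle \<open>f\<^sup>(\<^sup>1\<^sup>)\<close>.\<close>

definition derived ::
    "'a topology \<Rightarrow> 'a chart set \<Rightarrow> ('a \<Rightarrow> (real^('s::finite + 't::finite)) set)
      \<Rightarrow> 'a \<Rightarrow> (real^('s + 't)) set" where
  "derived T A f p =
     {\<sigma> p |\<sigma>. \<sigma> \<in> sections T A f} \<union>
     {dir_deriv c \<sigma> p \<xi> |c \<sigma> \<xi>. c \<in> charts_at A p \<and> \<sigma> \<in> sections T A f}"

definition legendre_map ::
    "'a topology \<Rightarrow> 'a chart set \<Rightarrow> ('a \<Rightarrow> (real^('s::finite + 't::finite)) set) \<Rightarrow> bool" where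
  "legendre_map T A f \<longleftrightarrow>
     smooth_null_bundle T A f \<and>
     (\<forall>p\<in>topspace T. derived T A f p \<subseteq> perp (f p)) \<and>
     (\<forall>p\<in>topspace T. \<forall>c\<in>charts_at A p. \<forall>\<xi>.
        (\<forall>\<sigma>\<in>sections T A f. dir_deriv c \<sigma> p \<xi> \<in> f p) \<longrightarrow> \<xi> = 0)"

text \<open>\<open>conf_rep T A f p c q\<close>: the function \<open>q\<close> of the coordinates \<open>\<xi>\<close> of a tangent vector \<open>X\<close> at
  \<open>p\<close> represents the induced conformal structure at \<open>p\<close>. That is, \<open>q \<xi>\<close> is the determinant of
  \<open>\<sigma> \<mapsto> d\<^sub>X\<sigma> mod f\<close>, from \<open>f p\<close> to \<open>perp (f p) / f p\<close>, with respect to some basis of \<open>f p\<close>, the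
  values at \<open>p\<close> of two sections \<open>\<sigma> i\<close>, and some basis of the quotient, the classes of two vectors
  \<open>w j\<close> of \<open>perp (f p)\<close> (these are bases by dimension count). Column \<open>i\<close> of the matrix \<open>a\<close> holds
  the coordinates of \<open>d\<^sub>X(\<sigma> i) mod f p\<close>. Other bases rescale \<open>q\<close> by a nonzero constant.\<close>

definition conf_rep ::
    "'a topology \<Rightarrow> 'a chart set \<Rightarrow> ('a \<Rightarrow> (real^('s::finite + 't::finite)) set)
      \<Rightarrow> 'a \<Rightarrow> 'a chart \<Rightarrow> (real^2 \<Rightarrow> real) \<Rightarrow> bool" where
  "conf_rep T A f p c q \<longleftrightarrow>
     (\<exists>(\<sigma> :: 2 \<Rightarrow> 'a \<Rightarrow> real^('s + 't)) (w :: 2 \<Rightarrow> real^('s + 't)).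
        (\<forall>i. \<sigma> i \<in> sections T A f) \<and>
        span (range (\<lambda>i. \<sigma> i p)) = f p \<and>
        span (f p \<union> range w) = perp (f p) \<and>
        (\<forall>\<xi>. \<exists>a :: real^2^2.
           (\<forall>i. dir_deriv c (\<sigma> i) p \<xi> - (\<Sum>j\<in>UNIV. a $ j $ i *\<^sub>R w j) \<in> f p) \<and>
           q \<xi> = det a))"

definition signature_1_1 :: "(real^2 \<Rightarrow> real) \<Rightarrow> bool" where
  "signature_1_1 q \<longleftrightarrow>
     (\<exists>e1 e2. e1 \<noteq> e2 \<and> independent {e1, e2} \<and>
        (\<forall>a b. q (a *\<^sub>R e1 + b *\<^sub>R e2) = a\<^sup>2 - b\<^sup>2))"

text \<open>Signature (1,1) does not change when the form is multiplied by a nonzero constant, so it is a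
  property of the conformal class, and it may be tested on any representative.\<close>

definition conf_signature_1_1 ::
    "'a topology \<Rightarrow> 'a chart set \<Rightarrow> ('a \<Rightarrow> (real^('s::finite + 't::finite)) set) \<Rightarrow> 'a \<Rightarrow> bool" where
  "conf_signature_1_1 T A f p \<longleftrightarrow>
     (\<forall>c\<in>charts_at A p. \<exists>q. conf_rep T A f p c q \<and> signature_1_1 q)"


section \<open>The projective model and deformations\<close>

text \<open>\<open>\<wedge>\<^sup>2\<real>\<^sup>n\<close> is the space of skew matrices. Points of its projective space are lines
  (one-dimensional subspaces) in it.\<close>

definition wedge :: "real^'n \<Rightarrow> real^'n \<Rightarrow> real^'n^'n" where
  "wedge v w = (\<chi> i j. v $ i * w $ j - w $ i * v $ j)"

definition wedge2 :: "(real^'n) set \<Rightarrow> (real^'n^'n) set" where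
  "wedge2 L = span {wedge v w |v w. v \<in> L \<and> w \<in> L}"

text \<open>The action of a matrix on lines of \<open>\<wedge>\<^sup>2\<real>\<^sup>n\<close>.\<close>

definition act :: "real^'n^'n \<Rightarrow> (real^'n^'n) set \<Rightarrow> (real^'n^'n) set" where
  "act M l = (\<lambda>S. M ** S ** transpose M) ` l"

lemma act_wedge: "M ** wedge v w ** transpose M = wedge (M *v v) (M *v w)"
  for M :: "real^'n^'n"
proof -
  have "(\<Sum>k\<in>UNIV. (\<Sum>l\<in>UNIV. M $ i $ l * (v $ l * w $ k - w $ l * v $ k)) * M $ j $ k) =
        (\<Sum>l\<in>UNIV. M $ i $ l * v $ l) * (\<Sum>k\<in>UNIV. M $ j $ k * w $ k) -
        (\<Sum>l\<in>UNIV. M $ i $ l * w $ l) * (\<Sum>k\<in>UNIV. M $ j $ k * v $ k)"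
    (is "?L = ?P * ?Q - ?R * ?S") for i j
  proof -
    have "?L = (\<Sum>k\<in>UNIV. ?P * (M $ j $ k * w $ k) - ?R * (M $ j $ k * v $ k))"
      by (intro sum.cong refl)
        (simp add: sum_distrib_left sum_distrib_right algebra_simps flip: sum_subtractf)
    then show ?thesis
      by (simp add: sum_subtractf sum_distrib_left)
  qed
  then show ?thesis
    by (simp add: vec_eq_iff wedge_def matrix_matrix_mult_def matrix_vector_mult_def transpose_def)
qed

text \<open>The affine chart of a projective space given by a linear functional \<open>\<phi>\<close>: a line on which
  \<open>\<phi>\<close> does not vanish goes to its point in the affine hyperplane \<open>\<phi> = 1\<close>.\<close>

definition affine_pt :: "('b::real_vector \<Rightarrow> real) \<Rightarrow> 'b set \<Rightarrow> 'b" where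
  "affine_pt \<phi> l = (THE x. x \<in> l \<and> \<phi> x = 1)"

text \<open>Equality of \<open>k\<close>-jets at \<open>p\<close> of two smooth maps into projective space, read in a chart of the
  surface and an affine chart around the common value (the choice does not matter).\<close>

definition agree_to_order ::
    "'a chart set \<Rightarrow> nat \<Rightarrow> ('a \<Rightarrow> (real^'n^'n) set) \<Rightarrow> ('a \<Rightarrow> (real^'n^'n) set) \<Rightarrow> 'a \<Rightarrow> bool" where
  "agree_to_order A k H F p \<longleftrightarrow>
     H p = F p \<and>
     (\<exists>\<phi>. linear \<phi> \<and> (\<exists>x\<in>F p. \<phi> x \<noteq> 0) \<and>
        (\<forall>c\<in>charts_at A p.
           jet_eq k (in_chart c (affine_pt \<phi> \<circ> H)) (in_chart c (affine_pt \<phi> \<circ> F)) (snd c p)))"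

definition deformation ::
    "'a topology \<Rightarrow> 'a chart set \<Rightarrow> nat \<Rightarrow> ('a \<Rightarrow> (real^('s::finite + 't::finite)) set)
      \<Rightarrow> ('a \<Rightarrow> (real^('s + 't)) set) \<Rightarrow> bool" where
  "deformation T A k f f' \<longleftrightarrow>
     smooth_null_bundle T A f' \<and>
     (\<exists>g. smooth_fun A (topspace T) g \<and> (\<forall>p\<in>topspace T. g p \<in> Ogroup) \<and>
        (\<forall>p\<in>topspace T.
           agree_to_order A k (\<lambda>q. act (matrix_inv (g p)) (wedge2 (f' q))) (\<lambda>q. wedge2 (f q)) p))"

definition trivial_deformation ::
    "'a topology \<Rightarrow> ('a \<Rightarrow> (real^('s::finite + 't::finite)) set)
      \<Rightarrow> ('a \<Rightarrow> (real^('s + 't)) set) \<Rightarrow> bool" where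
  "trivial_deformation T f f' \<longleftrightarrow>
     (\<exists>M\<in>Ogroup. \<forall>p\<in>topspace T. wedge2 (f' p) = act M (wedge2 (f p)))"

definition rigid_to_order ::
    "'a topology \<Rightarrow> 'a chart set \<Rightarrow> nat \<Rightarrow> ('a \<Rightarrow> (real^('s::finite + 't::finite)) set) \<Rightarrow> bool" where
  "rigid_to_order T A k f \<longleftrightarrow>
     \<not> (\<exists>f'. deformation T A k f f' \<and> \<not> trivial_deformation T f f')"

end

theory Submission
  imports Defs
begin

text \<open>If \<open>g\<close> realises a third order deformation, then for all sections \<open>\<sigma>\<close> of \<open>f\<close> and \<open>\<nu>\<close> of
  \<open>perp f\<close> the function \<open>q \<mapsto> (g(q) \<sigma>(q), g(p) \<nu>(q))\<close> vanishes to third order at \<open>q = p\<close>.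
  Differentiating in \<open>p\<close>, the function \<open>(g(q) \<sigma>(q), (d\<^sub>Zg)(p) \<nu>(q))\<close> vanishes to second order. Write
  \<open>\<alpha> = g\<^sup>-\<^sup>1 dg\<close>, let \<open>X\<close>, \<open>Y\<close> be null directions of the conformal structure and \<open>a\<close>, \<open>b\<close> the
  corresponding kernel sections of \<open>f\<close> at \<open>p\<close>; then \<open>f\<close>, \<open>d\<^sub>Ya\<close> and \<open>d\<^sub>Xb\<close> span \<open>perp f\<close>, and \<open>d\<^sub>Ya\<close>,
  \<open>d\<^sub>Xb\<close> are orthogonal and not null. The conditions of order 0, 1 and 2 give in turn
  \<open>\<alpha> f \<subseteq> f\<close>, then \<open>\<alpha> f = 0\<close>, then \<open>\<alpha> (perp f) = 0\<close>. Hence \<open>\<alpha>\<close> takes values in the line \<open>\<and>\<^sup>2f\<close>,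
  and \<open>d\<^sub>Zd\<^sub>Wg = d\<^sub>Wd\<^sub>Zg\<close> forces \<open>\<alpha> = 0\<close>, so \<open>g\<close> is locally constant.\<close>

section \<open>Directional derivatives, smooth functions and jets\<close>

text \<open>Since s + t = 6, the quotient of \<open>perp f\<close> by f is a plane and the conformal
  form is a determinant. Signature (1,1) gives two real null directions whose kernels differ, which
  is why a and b frame f. Second derivatives are controlled only through pairings: differentiating
  (a, d_X b) = 0 shows that (a, d_Y d_Y a) = -(d_Y a, d_Y a) is nonzero, while d_X d_Y a and d_X d_Y
  b stay in \<open>perp f\<close>. So testing on d_Y d_Y a or d_X d_X b reads off one coefficient,
  with respect to a and b, of a value of \<alpha> in f. Third order is used up exactly: one order
  pays for differentiating in p, and each of the remaining orders 0, 1, 2 removes one layer. A skew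
  form with values in the line of a and b satisfies all three conditions, so jets at a point can do
  no more. Integrability finishes by moving \<alpha>_X (d_Y d_Y a) to \<alpha>_Y (d_X d_Y a), which
  is zero because \<alpha> kills \<open>perp f\<close>.\<close>

definition dd :: "'a::real_normed_vector \<Rightarrow> ('a \<Rightarrow> 'b::real_normed_vector) \<Rightarrow> 'a \<Rightarrow> 'b" where
  "dd v h = (\<lambda>x. frechet_derivative h (at x) v)"

lemma Ck_on_Suc_dd:
  "Ck_on (Suc k) h U \<longleftrightarrow> (\<forall>x\<in>U. h differentiable (at x)) \<and> (\<forall>v. Ck_on k (dd v h) U)"
  by (simp add: dd_def)

declare Ck_on.simps(2) [simp del]

lemma dd_eqI: "(h has_derivative h') (at x) \<Longrightarrow> dd v h x = h' v"
  unfolding dd_def using frechet_derivative_at by metis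

lemma dd_works: "h differentiable (at x) \<Longrightarrow> (h has_derivative (\<lambda>v. dd v h x)) (at x)"
  unfolding dd_def by (simp add: frechet_derivative_works)

lemma differentiable_cong_open:
  assumes "open U" "x \<in> U" "\<And>y. y \<in> U \<Longrightarrow> f y = g y" "f differentiable (at x)"
  shows "g differentiable (at x)"
  using assms has_derivative_transform_within_open unfolding differentiable_def by metis

text \<open>\<open>frechet_derivative\<close> chooses from the set of derivatives at a point, and
  locally equal functions have the same set; the choices agree even where that set is empty.\<close>

lemma frechet_derivative_cong_open:
  assumes "open U" "x \<in> U" "\<And>y. y \<in> U \<Longrightarrow> f y = g y"
  shows "frechet_derivative f (at x) = frechet_derivative g (at x)"
proof -
  have "(f has_derivative D) (at x) \<longleftrightarrow> (g has_derivative D) (at x)" for D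
    using assms has_derivative_transform_within_open by metis
  then show ?thesis
    by (simp add: frechet_derivative_def)
qed

lemma Ck_on_cong:
  assumes "open U" "\<And>y. y \<in> U \<Longrightarrow> f y = g y" "Ck_on k f U"
  shows "Ck_on k g U"
  using assms(2,3)
proof (induction k arbitrary: f g)
  case 0
  then show ?case by (simp cong: continuous_on_cong)
next
  case (Suc k)
  have "g differentiable (at x)" if "x \<in> U" for x
    using differentiable_cong_open[OF assms(1) that] Suc.prems that unfolding Ck_on_Suc_dd by blast
  moreover have "Ck_on k (dd v g) U" for v
  proof (rule Suc.IH)
    show "dd v f y = dd v g y" if "y \<in> U" for y
      using frechet_derivative_cong_open[OF assms(1) that, of f g] Suc.prems by (simp add: dd_def)
    show "Ck_on k (dd v f) U"
      using Suc.prems unfolding Ck_on_Suc_dd by blast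
  qed
  ultimately show ?case unfolding Ck_on_Suc_dd by blast
qed

lemma Ck_on_subset: "Ck_on k f U \<Longrightarrow> V \<subseteq> U \<Longrightarrow> Ck_on k f V"
proof (induction k arbitrary: f)
  case 0
  then show ?case using continuous_on_subset by auto
next
  case (Suc k)
  then show ?case unfolding Ck_on_Suc_dd by blast
qed

lemma Ck_on_Suc_imp: "Ck_on (Suc k) f U \<Longrightarrow> Ck_on k f U"
proof (induction k arbitrary: f)
  case 0
  then show ?case
    unfolding Ck_on_Suc_dd
    by (auto intro!: continuous_at_imp_continuous_on dest: differentiable_imp_continuous_within)
next
  case (Suc k)
  then show ?case unfolding Ck_on_Suc_dd by blast
qed

lemma Ck_on_const [simp]: "Ck_on k (\<lambda>x. c) U"
  by (induction k arbitrary: c) (auto simp: Ck_on_Suc_dd dd_def)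

lemma dd_add:
  "f differentiable (at x) \<Longrightarrow> g differentiable (at x) \<Longrightarrow> dd v (\<lambda>y. f y + g y) x = dd v f x + dd v g x"
  by (rule dd_eqI) (intro has_derivative_add dd_works)

lemma dd_diff:
  "f differentiable (at x) \<Longrightarrow> g differentiable (at x) \<Longrightarrow> dd v (\<lambda>y. f y - g y) x = dd v f x - dd v g x"
  by (rule dd_eqI) (intro has_derivative_diff dd_works)

lemma dd_bounded_linear:
  assumes "bounded_linear L" "f differentiable (at x)"
  shows "dd v (\<lambda>y. L (f y)) x = L (dd v f x)"
  using bounded_linear.has_derivative[OF assms(1) dd_works[OF assms(2)]] by (rule dd_eqI)

lemma dd_bilinear:
  assumes "bounded_bilinear B" "f differentiable (at x)" "g differentiable (at x)"
  shows "dd v (\<lambda>y. B (f y) (g y)) x = B (f x) (dd v g x) + B (dd v f x) (g x)"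
  using bounded_bilinear.FDERIV[OF assms(1) dd_works[OF assms(2)] dd_works[OF assms(3)]]
  by (rule dd_eqI)

lemma Ck_on_add:
  assumes "open U" "Ck_on k f U" "Ck_on k g U"
  shows "Ck_on k (\<lambda>x. f x + g x) U"
  using assms(2,3)
proof (induction k arbitrary: f g)
  case 0
  then show ?case by (simp add: continuous_on_add)
next
  case (Suc k)
  have "Ck_on k (dd v (\<lambda>x. f x + g x)) U" for v
    by (rule Ck_on_cong[OF assms(1) _ Suc.IH[of "dd v f" "dd v g"]])
      (use Suc.prems in \<open>auto simp: Ck_on_Suc_dd dd_add\<close>)
  then show ?case using Suc.prems by (auto simp: Ck_on_Suc_dd)
qed

text \<open>The Leibniz rule gives two terms of the same bilinear shape with one factor
  differentiated, so the induction runs over all pairs of factors.\<close>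

lemma Ck_on_bilinear:
  assumes "open U" "bounded_bilinear B" "Ck_on k f U" "Ck_on k g U"
  shows "Ck_on k (\<lambda>x. B (f x) (g x)) U"
  using assms(3,4)
proof (induction k arbitrary: f g)
  case 0
  then show ?case by (simp add: bounded_bilinear.continuous_on[OF assms(2)])
next
  case (Suc k)
  have "Ck_on k (dd v (\<lambda>x. B (f x) (g x))) U" for v
    by (rule Ck_on_cong[OF assms(1) _ Ck_on_add[OF assms(1) Suc.IH[of f "dd v g"] Suc.IH[of "dd v f" g]]])
      (use Suc.prems Ck_on_Suc_imp in \<open>auto simp: Ck_on_Suc_dd dd_bilinear[OF assms(2)]\<close>)
  moreover have "(\<lambda>x. B (f x) (g x)) differentiable (at x)" if "x \<in> U" for x
    using Suc.prems that unfolding Ck_on_Suc_dd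
    by (blast intro: differentiableI[OF bounded_bilinear.FDERIV[OF assms(2) dd_works dd_works]])
  ultimately show ?case by (auto simp: Ck_on_Suc_dd)
qed

text \<open>The derivative of 1/f is a product of 1/f, f' and 1/f, and the induction hypothesis
  supplies 1/f one order lower.\<close>

lemma Ck_on_inverse:
  fixes f :: "'a::real_normed_vector \<Rightarrow> real"
  assumes "open U" "Ck_on k f U" "\<And>x. x \<in> U \<Longrightarrow> f x \<noteq> 0"
  shows "Ck_on k (\<lambda>x. inverse (f x)) U"
  using assms(2)
proof (induction k)
  case 0
  then show ?case using assms(3) by (simp add: continuous_on_inverse)
next
  case (Suc k)
  have der: "((\<lambda>x. inverse (f x)) has_derivative (\<lambda>v. - (inverse (f x) * dd v f x * inverse (f x)))) (at x)"
    if "x \<in> U" for x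
    using Deriv.has_derivative_inverse[OF assms(3)[OF that] dd_works[of f x]] Suc.prems that
    unfolding Ck_on_Suc_dd by auto
  have inv: "Ck_on k (\<lambda>x. inverse (f x)) U"
    using Suc Ck_on_Suc_imp by blast
  have "Ck_on k (\<lambda>x. (- 1) * (inverse (f x) * dd v f x * inverse (f x))) U" for v
    by (intro Ck_on_bilinear[OF assms(1) bounded_bilinear_mult] inv Ck_on_const)
      (use Suc.prems Ck_on_Suc_dd in blast)
  then have "Ck_on k (dd v (\<lambda>x. inverse (f x))) U" for v
    by (rule Ck_on_cong[OF assms(1), rotated]) (use dd_eqI[OF der] in auto)
  then show ?case
    using der by (auto simp: Ck_on_Suc_dd differentiable_def)
qed

lemma smooth_on_dd: "smooth_on h U \<Longrightarrow> smooth_on (dd v h) U"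
  unfolding smooth_on_def using Ck_on_Suc_dd by blast

lemma smooth_on_differentiable: "smooth_on h U \<Longrightarrow> x \<in> U \<Longrightarrow> h differentiable (at x)"
  unfolding smooth_on_def using Ck_on_Suc_dd by blast

lemma smooth_on_continuous_on: "smooth_on h U \<Longrightarrow> continuous_on U h"
  unfolding smooth_on_def using Ck_on.simps(1) by blast

lemma smooth_on_subset: "smooth_on h U \<Longrightarrow> V \<subseteq> U \<Longrightarrow> smooth_on h V"
  unfolding smooth_on_def using Ck_on_subset by blast

lemma smooth_on_const [simp]: "smooth_on (\<lambda>x. c) U"
  by (simp add: smooth_on_def)

lemma smooth_on_add:
  "open U \<Longrightarrow> smooth_on f U \<Longrightarrow> smooth_on g U \<Longrightarrow> smooth_on (\<lambda>x. f x + g x) U"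
  by (simp add: smooth_on_def Ck_on_add)

lemma smooth_on_bilinear:
  "bounded_bilinear B \<Longrightarrow> open U \<Longrightarrow> smooth_on f U \<Longrightarrow> smooth_on g U \<Longrightarrow> smooth_on (\<lambda>x. B (f x) (g x)) U"
  by (simp add: smooth_on_def Ck_on_bilinear)

text \<open>A linear map is the bilinear map \<open>a *\<^sub>R L y\<close> frozen at a = 1, which
  reduces this to the product rule.\<close>

lemma smooth_on_bounded_linear:
  assumes "bounded_linear L" "open U" "smooth_on f U"
  shows "smooth_on (\<lambda>x. L (f x)) U"
proof -
  interpret L: bounded_linear L by fact
  have "bounded_bilinear (\<lambda>(a::real) y. a *\<^sub>R L y)"
    by (rule bounded_bilinear.comp[OF bounded_bilinear_scaleR bounded_linear_ident assms(1)])
  then have "smooth_on (\<lambda>x. 1 *\<^sub>R L (f x)) U"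
    by (rule smooth_on_bilinear) (use assms in auto)
  then show ?thesis by simp
qed

lemma smooth_on_diff:
  assumes "open U" "smooth_on f U" "smooth_on g U"
  shows "smooth_on (\<lambda>x. f x - g x) U"
  using smooth_on_add[OF assms(1,2) smooth_on_bounded_linear[OF bounded_linear_minus[OF bounded_linear_ident] assms(1,3)]]
  by simp

lemma smooth_on_inverse:
  fixes f :: "'a::real_normed_vector \<Rightarrow> real"
  shows "open U \<Longrightarrow> smooth_on f U \<Longrightarrow> (\<And>x. x \<in> U \<Longrightarrow> f x \<noteq> 0) \<Longrightarrow> smooth_on (\<lambda>x. inverse (f x)) U"
  by (simp add: smooth_on_def Ck_on_inverse)

lemma linear_dd: "h differentiable (at x) \<Longrightarrow> linear (\<lambda>v. dd v h x)"
  unfolding dd_def using linear_frechet_derivative eta_contract_eq by metis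

section \<open>Jets that vanish at a point\<close>

fun zero_jet :: "nat \<Rightarrow> ('a::real_normed_vector \<Rightarrow> 'b::real_normed_vector) \<Rightarrow> 'a \<Rightarrow> bool" where
  "zero_jet 0 h x \<longleftrightarrow> h x = 0"
| "zero_jet (Suc k) h x \<longleftrightarrow> h x = 0 \<and> (\<forall>v. zero_jet k (dd v h) x)"

lemma zero_jet_cong:
  assumes "open U" "x \<in> U" "\<And>y. y \<in> U \<Longrightarrow> f y = g y" "zero_jet k f x"
  shows "zero_jet k g x"
  using assms(3,4)
proof (induction k arbitrary: f g)
  case 0
  then show ?case using assms(2) by simp
next
  case (Suc k)
  have "zero_jet k (dd v g) x" for v
  proof (rule Suc.IH)
    show "dd v f y = dd v g y" if "y \<in> U" for y
      using frechet_derivative_cong_open[OF assms(1) that, of f g] Suc.prems by (simp add: dd_def)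
  qed (use Suc.prems in auto)
  then show ?case using Suc.prems assms(2) by auto
qed

lemma jet_eq_cong:
  assumes "open U" "x \<in> U" "\<And>y. y \<in> U \<Longrightarrow> f y = f' y" "\<And>y. y \<in> U \<Longrightarrow> g y = g' y" "jet_eq k f g x"
  shows "jet_eq k f' g' x"
  using assms(3-5)
proof (induction k arbitrary: f g f' g')
  case 0
  then show ?case using assms(2) by simp
next
  case (Suc k)
  have "jet_eq k (\<lambda>y. frechet_derivative f' (at y) v) (\<lambda>y. frechet_derivative g' (at y) v) x" for v
  proof (rule Suc.IH)
    show "frechet_derivative f (at y) v = frechet_derivative f' (at y) v"
      and "frechet_derivative g (at y) v = frechet_derivative g' (at y) v" if "y \<in> U" for y
      using frechet_derivative_cong_open[OF assms(1) that, of f f']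
        frechet_derivative_cong_open[OF assms(1) that, of g g'] Suc.prems(1,2) by auto
  qed (use Suc.prems(3) in auto)
  then show ?case using Suc.prems assms(2) by auto
qed

lemma zero_jet_mono: "zero_jet (Suc k) h x \<Longrightarrow> zero_jet k h x"
  by (induction k arbitrary: h) auto

lemma zero_jet_add:
  assumes "open U" "x \<in> U" "smooth_on f U" "smooth_on g U" "zero_jet k f x" "zero_jet k g x"
  shows "zero_jet k (\<lambda>y. f y + g y) x"
  using assms(3-6)
proof (induction k arbitrary: f g)
  case (Suc k)
  have "zero_jet k (dd v (\<lambda>y. f y + g y)) x" for v
    by (rule zero_jet_cong[OF assms(1,2) _ Suc.IH[of "dd v f" "dd v g"]])
      (use Suc.prems in \<open>auto simp: dd_add smooth_on_dd smooth_on_differentiable[where U = U]\<close>)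
  then show ?case using Suc.prems by auto
qed auto

text \<open>The ideal property of vanishing jets: of the two Leibniz terms, one keeps f and the
  other contains its derivative, and both vanish to order k.\<close>

lemma zero_jet_bilinear:
  assumes "bounded_bilinear B" "open U" "x \<in> U" "smooth_on f U" "smooth_on g U" "zero_jet k f x"
  shows "zero_jet k (\<lambda>y. B (f y) (g y)) x"
  using assms(4-6)
proof (induction k arbitrary: f g)
  case 0
  then show ?case by (simp add: bounded_bilinear.zero_left[OF assms(1)])
next
  case (Suc k)
  have "zero_jet k (dd v (\<lambda>y. B (f y) (g y))) x" for v
  proof (rule zero_jet_cong[OF assms(2,3)])
    show "zero_jet k (\<lambda>y. B (f y) (dd v g y) + B (dd v f y) (g y)) x"
      using Suc.prems zero_jet_mono
      by (intro zero_jet_add[OF assms(2,3)] Suc.IH smooth_on_bilinear[OF assms(1,2)])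
        (auto intro: smooth_on_dd)
  qed (use Suc.prems in \<open>auto simp: dd_bilinear[OF assms(1)] smooth_on_differentiable[where U = U]\<close>)
  then show ?case using Suc.prems by (auto simp: bounded_bilinear.zero_left[OF assms(1)])
qed

lemma zero_jet_bounded_linear:
  assumes "bounded_linear L" "open U" "x \<in> U" "smooth_on f U" "zero_jet k f x"
  shows "zero_jet k (\<lambda>y. L (f y)) x"
proof -
  have "bounded_bilinear (\<lambda>y (a::real). a *\<^sub>R L y)"
    by (rule bounded_bilinear.flip[OF bounded_bilinear.comp[OF bounded_bilinear_scaleR bounded_linear_ident assms(1)]])
  from zero_jet_bilinear[OF this assms(2-4) smooth_on_const assms(5), of 1] show ?thesis by simp
qed

lemma jet_eq_imp_zero_jet:
  assumes "open U" "x \<in> U" "smooth_on f U" "smooth_on g U" "jet_eq k f g x"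
  shows "zero_jet k (\<lambda>y. f y - g y) x"
  using assms(3-5)
proof (induction k arbitrary: f g)
  case (Suc k)
  have "zero_jet k (dd v (\<lambda>y. f y - g y)) x" for v
    by (rule zero_jet_cong[OF assms(1,2) _ Suc.IH[of "dd v f" "dd v g"]])
      (use Suc.prems in \<open>auto simp: dd_diff smooth_on_dd dd_def[symmetric] smooth_on_differentiable[where U = U]\<close>)
  then show ?case using Suc.prems by auto
qed auto

section \<open>Symmetry of second derivatives\<close>

text \<open>The mean value theorem is used twice: along v for the difference across the w edge, then
  along w for the derivative so obtained.\<close>

lemma second_difference_mvt:
  fixes h :: "'a::real_normed_vector \<Rightarrow> real"
  assumes U: "open U" "smooth_on h U" and r: "0 < r"
    and sub: "\<And>s t. 0 \<le> s \<Longrightarrow> s \<le> r \<Longrightarrow> 0 \<le> t \<Longrightarrow> t \<le> r \<Longrightarrow> x + s *\<^sub>R v + t *\<^sub>R w \<in> U"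
  shows "\<exists>s t. 0 < s \<and> s < r \<and> 0 < t \<and> t < r \<and>
    h (x + r *\<^sub>R v + r *\<^sub>R w) - h (x + r *\<^sub>R v) - h (x + r *\<^sub>R w) + h x =
    r * r * dd w (dd v h) (x + s *\<^sub>R v + t *\<^sub>R w)"
proof -
  have der1: "((\<lambda>s. k (x + s *\<^sub>R v + t *\<^sub>R w)) has_real_derivative dd v k (x + s *\<^sub>R v + t *\<^sub>R w)) (at s)"
    if "smooth_on k U" "0 \<le> s" "s \<le> r" "0 \<le> t" "t \<le> r" for k :: "'a \<Rightarrow> real" and s t
  proof -
    have d: "k differentiable (at (x + s *\<^sub>R v + t *\<^sub>R w))"
      using that sub smooth_on_differentiable by blast
    have "((\<lambda>s. x + s *\<^sub>R v + t *\<^sub>R w) has_derivative (\<lambda>a. a *\<^sub>R v)) (at s)"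
      by (auto intro!: derivative_eq_intros)
    from has_derivative_compose[OF this dd_works[OF d]]
    have "((\<lambda>s. k (x + s *\<^sub>R v + t *\<^sub>R w)) has_derivative (\<lambda>a. dd (a *\<^sub>R v) k (x + s *\<^sub>R v + t *\<^sub>R w))) (at s)" .
    then show ?thesis
      by (simp add: has_field_derivative_def linear_scale[OF linear_dd[OF d]] mult.commute[of _ "dd v k _"])
  qed
  have der2: "((\<lambda>t. k (x + s *\<^sub>R v + t *\<^sub>R w)) has_real_derivative dd w k (x + s *\<^sub>R v + t *\<^sub>R w)) (at t)"
    if "smooth_on k U" "0 \<le> s" "s \<le> r" "0 \<le> t" "t \<le> r" for k :: "'a \<Rightarrow> real" and s t
  proof -
    have d: "k differentiable (at (x + s *\<^sub>R v + t *\<^sub>R w))"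
      using that sub smooth_on_differentiable by blast
    have "((\<lambda>t. x + s *\<^sub>R v + t *\<^sub>R w) has_derivative (\<lambda>a. a *\<^sub>R w)) (at t)"
      by (auto intro!: derivative_eq_intros)
    from has_derivative_compose[OF this dd_works[OF d]]
    have "((\<lambda>t. k (x + s *\<^sub>R v + t *\<^sub>R w)) has_derivative (\<lambda>a. dd (a *\<^sub>R w) k (x + s *\<^sub>R v + t *\<^sub>R w))) (at t)" .
    then show ?thesis
      by (simp add: has_field_derivative_def linear_scale[OF linear_dd[OF d]] mult.commute[of _ "dd w k _"])
  qed
  define g where "g s = h (x + s *\<^sub>R v + r *\<^sub>R w) - h (x + s *\<^sub>R v + 0 *\<^sub>R w)" for s
  have "\<exists>s. 0 < s \<and> s < r \<and> g r - g 0 =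
      (r - 0) * (dd v h (x + s *\<^sub>R v + r *\<^sub>R w) - dd v h (x + s *\<^sub>R v + 0 *\<^sub>R w))"
    unfolding g_def using r U by (intro MVT2 DERIV_diff der1) auto
  then obtain s where s: "0 < s" "s < r" "g r - g 0 =
      r * (dd v h (x + s *\<^sub>R v + r *\<^sub>R w) - dd v h (x + s *\<^sub>R v + 0 *\<^sub>R w))" by auto
  have "\<exists>t. 0 < t \<and> t < r \<and> dd v h (x + s *\<^sub>R v + r *\<^sub>R w) - dd v h (x + s *\<^sub>R v + 0 *\<^sub>R w) =
      (r - 0) * dd w (dd v h) (x + s *\<^sub>R v + t *\<^sub>R w)"
    using r s U smooth_on_dd by (intro MVT2 der2) auto
  then obtain t where t: "0 < t" "t < r" "dd v h (x + s *\<^sub>R v + r *\<^sub>R w) - dd v h (x + s *\<^sub>R v + 0 *\<^sub>R w) =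
      r * dd w (dd v h) (x + s *\<^sub>R v + t *\<^sub>R w)" by auto
  show ?thesis
    using s t by (intro exI[of _ s] exI[of _ t]) (simp add: g_def algebra_simps)
qed

text \<open>The second difference is symmetric in v and w, so the two mixed derivatives share a
  value at points arbitrarily near x, and continuity brings it to x.\<close>

lemma dd_commute_real:
  fixes h :: "'a::real_normed_vector \<Rightarrow> real"
  assumes U: "open U" "smooth_on h U" and x: "x \<in> U"
  shows "dd w (dd v h) x = dd v (dd w h) x"
proof (rule ccontr)
  assume ne: "dd w (dd v h) x \<noteq> dd v (dd w h) x"
  \<comment> \<open>Half the gap: two errors below \<open>e\<close> cannot bridge it.\<close>
  define e where "e = \<bar>dd w (dd v h) x - dd v (dd w h) x\<bar> / 2"
  have e: "e > 0" using ne by (simp add: e_def)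
  have cont: "\<exists>d>0. \<forall>y\<in>U. dist y x < d \<longrightarrow> dist (dd b (dd a h) y) (dd b (dd a h) x) < e" for a b
    using smooth_on_continuous_on[OF smooth_on_dd[OF smooth_on_dd[OF U(2)]]] x e
    unfolding continuous_on_iff by blast
  obtain d1 where d1: "d1 > 0" "\<And>y. y \<in> U \<Longrightarrow> dist y x < d1 \<Longrightarrow> dist (dd w (dd v h) y) (dd w (dd v h) x) < e"
    using cont by metis
  obtain d2 where d2: "d2 > 0" "\<And>y. y \<in> U \<Longrightarrow> dist y x < d2 \<Longrightarrow> dist (dd v (dd w h) y) (dd v (dd w h) x) < e"
    using cont by metis
  obtain d0 where d0: "d0 > 0" "ball x d0 \<subseteq> U"
    using U x open_contains_ball by metis
  define d where "d = min d0 (min d1 d2)"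
  have d: "d > 0" using d0 d1 d2 by (simp add: d_def)
  \<comment> \<open>The 1 keeps \<open>c\<close> positive when v = w = 0. Below, r * c = d / 2 keeps
    the whole parallelogram within distance d of x.\<close>
  define c where "c = norm v + norm w + 1"
  have c: "c > 0" by (simp add: c_def add_nonneg_pos)
  define r where "r = d / (2 * c)"
  have r: "r > 0" using d c by (simp add: r_def)
  have near: "dist (x + s *\<^sub>R v + t *\<^sub>R w) x < d" if "0 \<le> s" "s \<le> r" "0 \<le> t" "t \<le> r" for s t
  proof -
    have "dist (x + s *\<^sub>R v + t *\<^sub>R w) x \<le> norm (s *\<^sub>R v) + norm (t *\<^sub>R w)"
      using norm_triangle_ineq[of "s *\<^sub>R v" "t *\<^sub>R w"] by (simp add: dist_norm add.assoc)
    also have "\<dots> \<le> r * norm v + r * norm w"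
      using that by (intro add_mono) (auto intro: mult_right_mono)
    also have "\<dots> \<le> r * c" using r by (simp add: c_def algebra_simps)
    also have "\<dots> < d" using d c by (simp add: r_def)
    finally show ?thesis .
  qed
  have inU: "x + s *\<^sub>R v + t *\<^sub>R w \<in> U" if "0 \<le> s" "s \<le> r" "0 \<le> t" "t \<le> r" for s t
    using near[OF that] d0 by (auto simp: d_def dist_commute subset_iff)
  have inU': "x + t *\<^sub>R w + s *\<^sub>R v \<in> U" if "0 \<le> t" "t \<le> r" "0 \<le> s" "s \<le> r" for s t
    using inU[OF that(3,4,1,2)] by (simp add: algebra_simps)
  obtain s t where st: "0 < s" "s < r" "0 < t" "t < r"
    "h (x + r *\<^sub>R v + r *\<^sub>R w) - h (x + r *\<^sub>R v) - h (x + r *\<^sub>R w) + h x =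
      r * r * dd w (dd v h) (x + s *\<^sub>R v + t *\<^sub>R w)"
    using second_difference_mvt[OF U r inU] by blast
  obtain t' s' where st': "0 < t'" "t' < r" "0 < s'" "s' < r"
    "h (x + r *\<^sub>R w + r *\<^sub>R v) - h (x + r *\<^sub>R w) - h (x + r *\<^sub>R v) + h x =
      r * r * dd v (dd w h) (x + t' *\<^sub>R w + s' *\<^sub>R v)"
    using second_difference_mvt[OF U r inU'] by blast
  have eq: "dd w (dd v h) (x + s *\<^sub>R v + t *\<^sub>R w) = dd v (dd w h) (x + s' *\<^sub>R v + t' *\<^sub>R w)"
  proof -
    have "r * r * dd w (dd v h) (x + s *\<^sub>R v + t *\<^sub>R w) = r * r * dd v (dd w h) (x + t' *\<^sub>R w + s' *\<^sub>R v)"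
      using st(5) st'(5) by (simp add: algebra_simps)
    then show ?thesis using r by (simp add: algebra_simps)
  qed
  have "dist (dd w (dd v h) (x + s *\<^sub>R v + t *\<^sub>R w)) (dd w (dd v h) x) < e"
    using d1(2) inU[of s t] near[of s t] st by (auto simp: d_def)
  moreover have "dist (dd v (dd w h) (x + s' *\<^sub>R v + t' *\<^sub>R w)) (dd v (dd w h) x) < e"
    using d2(2) inU[of s' t'] near[of s' t'] st' by (auto simp: d_def)
  ultimately show False
    using eq by (simp add: e_def dist_real_def abs_if split: if_splits)
qed

lemma dd_commute:
  fixes h :: "'a::real_normed_vector \<Rightarrow> 'b::euclidean_space"
  assumes U: "open U" "smooth_on h U" and x: "x \<in> U"
  shows "dd w (dd v h) x = dd v (dd w h) x"
proof (rule euclidean_eqI)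
  fix b :: 'b assume "b \<in> Basis"
  have bl: "bounded_linear (\<lambda>y::'b. y \<bullet> b)" by (rule bounded_linear_inner_left)
  have *: "dd q (dd p (\<lambda>y. h y \<bullet> b)) x = dd q (dd p h) x \<bullet> b" for p q
  proof -
    have "dd q (dd p (\<lambda>y. h y \<bullet> b)) x = dd q (\<lambda>y. dd p h y \<bullet> b) x"
      using dd_bounded_linear[OF bl smooth_on_differentiable[OF U(2)]]
        frechet_derivative_cong_open[OF U(1) x, of "dd p (\<lambda>y. h y \<bullet> b)" "\<lambda>y. dd p h y \<bullet> b"]
      by (simp add: dd_def)
    also have "\<dots> = dd q (dd p h) x \<bullet> b"
      by (rule dd_bounded_linear[OF bl smooth_on_differentiable[OF smooth_on_dd[OF U(2)] x]])
    finally show ?thesis .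
  qed
  show "dd w (dd v h) x \<bullet> b = dd v (dd w h) x \<bullet> b"
    using dd_commute_real[OF U(1) smooth_on_bounded_linear[OF bl U] x, of w v] by (simp add: *)
qed

section \<open>Null planes and adapted frames\<close>

text \<open>The Gram matrix of \<open>ip\<close> as an involution. It reduces \<open>ip\<close> to
  the Euclidean inner product, so that dimension counts for orthogonal complements apply.\<close>

definition flip :: "real^('s::finite + 't::finite) \<Rightarrow> real^('s + 't)" where
  "flip x = (\<chi> k. case k of Inl i \<Rightarrow> x $ Inl i | Inr j \<Rightarrow> - x $ Inr j)"

lemma ip_flip: "ip x y = flip x \<bullet> y"
proof -
  have "flip x \<bullet> y = (\<Sum>k\<in>UNIV <+> UNIV. flip x $ k * y $ k)"
    by (simp add: inner_vec_def)
  also have "\<dots> = ip x y"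
    by (subst sum.Plus) (simp_all add: ip_def flip_def sum_negf)
  finally show ?thesis ..
qed

lemma linear_flip: "linear flip"
  by (rule linearI) (auto simp: flip_def vec_eq_iff split: sum.splits)

lemma flip_flip [simp]: "flip (flip x) = x"
  by (auto simp: flip_def vec_eq_iff split: sum.splits)

lemma inj_flip: "inj flip"
  by (metis flip_flip injI)

lemma bounded_bilinear_ip: "bounded_bilinear ip"
  using bounded_bilinear.comp[OF bounded_bilinear_inner linear_conv_bounded_linear[THEN iffD1, OF linear_flip] bounded_linear_ident]
  by (simp add: ip_flip[abs_def])

interpretation ip: bounded_bilinear ip
  by (rule bounded_bilinear_ip)

lemma ip_commute: "ip x y = ip y x"
  by (simp add: ip_def mult.commute)

lemma ip_nondegenerate: "(\<And>y. ip x y = 0) \<Longrightarrow> x = 0"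
  using ip_flip inner_eq_zero_iff flip_flip linear_0[OF linear_flip] by metis

lemma subspace_perp: "subspace (perp L)"
  by (rule subspaceI) (auto simp: perp_def ip.add_left ip.scaleR_left ip.zero_left)

lemma dim_perp:
  fixes L :: "(real^('s::finite + 't::finite)) set"
  assumes "subspace L"
  shows "dim (perp L) + dim L = CARD('s) + CARD('t)"
proof -
  have "perp L = {y \<in> UNIV. \<forall>x\<in>flip ` L. orthogonal x y}"
    by (auto simp: perp_def orthogonal_def ip_commute ip_flip[symmetric])
  moreover have "dim (flip ` L) = dim L"
    using linear_flip inj_flip by (intro dim_image_eq) (auto intro: inj_on_subset)
  moreover have "dim {y \<in> UNIV. \<forall>x\<in>flip ` L. orthogonal x y} + dim (flip ` L) = dim (UNIV :: (real^('s + 't)) set)"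
    using assms linear_flip by (intro dim_subspace_orthogonal_to_vectors) (auto intro: linear_subspace_image)
  ultimately show ?thesis by simp
qed

lemma perp_perp:
  assumes "subspace L"
  shows "perp (perp L) = L"
proof -
  have "L \<subseteq> perp (perp L)" by (auto simp: perp_def ip_commute)
  moreover have "dim (perp (perp L)) = dim L"
    using dim_perp[OF assms] dim_perp[OF subspace_perp, of L] by simp
  ultimately show ?thesis
    using assms subspace_perp subspace_dim_equal by (metis order_refl)
qed

lemma mem_perp_span: "x \<in> perp (span S) \<longleftrightarrow> (\<forall>y\<in>S. ip x y = 0)"
proof
  assume S: "\<forall>y\<in>S. ip x y = 0"
  have "subspace {y. ip x y = 0}"
    by (rule subspaceI) (auto simp: ip.add_right ip.scaleR_right ip.zero_right)
  then have "span S \<subseteq> {y. ip x y = 0}"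
    using S by (intro span_minimal) auto
  then show "x \<in> perp (span S)" by (auto simp: perp_def)
qed (auto simp: perp_def span_base)

lemma Ogroup_ip: "M \<in> Ogroup \<Longrightarrow> ip (M *v x) (M *v y) = ip x y"
  by (simp add: Ogroup_def)

text \<open>A vector killed by M is orthogonal to everything, because M preserves a nondegenerate
  form.\<close>

lemma Ogroup_invertible:
  assumes "M \<in> Ogroup"
  shows "invertible M"
proof -
  have "x = 0" if "M *v x = 0" for x
    using Ogroup_ip[OF assms, of x] that ip_nondegenerate[of x] by (simp add: ip.zero_left)
  then show ?thesis
    using invertible_left_inverse matrix_left_invertible_ker by blast
qed

lemma matrix_inv_mult:
  fixes M :: "real^'n^'n"
  assumes "invertible M"
  shows "M ** matrix_inv M = mat 1" "matrix_inv M ** M = mat 1"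
  using someI_ex[OF assms[unfolded invertible_def]] unfolding matrix_inv_def by auto

lemma span_pair: "span {a, b} = {x *\<^sub>R a + y *\<^sub>R b | x y. True}"
  by (auto simp: span_insert span_singleton) (metis add_diff_cancel_left' diff_add_cancel add.commute)+

text \<open>The vectors are the values at a point of a frame \<open>a, b\<close> of the bundle and of its first and second
  derivatives along two null directions 1, 2 of the conformal structure, where \<open>a\<close> spans the kernel
  of the derivative along 1 and \<open>b\<close> the kernel of the derivative along 2.\<close>

locale adapted_frame =
  fixes a b a1 a2 b1 b2 a11 a12 a22 b11 b12 b22 :: "real^('s::finite + 't::finite)"
  assumes null: "ip a a = 0" "ip a b = 0" "ip b b = 0"
    and contact: "ip a a1 = 0" "ip a a2 = 0" "ip a b1 = 0" "ip a b2 = 0"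
      "ip b a1 = 0" "ip b a2 = 0" "ip b b1 = 0" "ip b b2 = 0"
    and kernel: "a1 \<in> span {a, b}" "b2 \<in> span {a, b}"
    and middle: "ip a2 b1 = 0" "ip a2 a2 \<noteq> 0" "ip b1 b1 \<noteq> 0"
    and second: "ip a a11 = 0" "ip a a12 = 0" "ip a a22 = - ip a2 a2"
      "ip a b11 = 0" "ip a b12 = 0" "ip a b22 = 0"
      "ip b a11 = 0" "ip b a12 = 0" "ip b a22 = 0"
      "ip b b11 = - ip b1 b1" "ip b b12 = 0" "ip b b22 = 0"
    and maximal: "ip v a = 0 \<Longrightarrow> ip v b = 0 \<Longrightarrow> ip v a2 = 0 \<Longrightarrow> ip v b1 = 0 \<Longrightarrow> v \<in> span {a, b}"
begin

text \<open>The symmetry exchanging a with b and direction 1 with direction 2. Each statement about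
  \<open>A a\<close> or \<open>A b1\<close> thereby yields its counterpart for \<open>A b\<close> or
  \<open>A a2\<close>.\<close>

lemma swap: "adapted_frame b a b2 b1 a2 a1 b22 b12 b11 a22 a12 a11"
  by unfold_locales
    (use null contact kernel middle second maximal in \<open>auto simp: insert_commute ip_commute\<close>)

lemma mem_span: "v \<in> span {a, b} \<longleftrightarrow> (\<exists>x y. v = x *\<^sub>R a + y *\<^sub>R b)"
  by (auto simp: span_pair)

end

section \<open>Elements of the Lie algebra so(s,t) acting on an adapted frame\<close>

locale skew_map =
  fixes A :: "real^('s::finite + 't::finite) \<Rightarrow> real^('s + 't)"
  assumes lin: "linear A" and skew: "ip u (A v) = - ip (A u) v"
begin

lemma skew_diag: "ip v (A v) = 0"
  using skew[of v v] by (simp add: ip_commute)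

end

locale adapted_skew = adapted_frame a b a1 a2 b1 b2 a11 a12 a22 b11 b12 b22 + skew_map A
  for a b a1 a2 b1 b2 a11 a12 a22 b11 b12 b22 :: "real^('s::finite + 't::finite)"
    and A :: "real^('s + 't) \<Rightarrow> real^('s + 't)"
begin

lemma swap_skew: "adapted_skew b a b2 b1 a2 a1 b22 b12 b11 a22 a12 a11 A"
  by (intro adapted_skew.intro swap skew_map_axioms)

text \<open>Write A a = x a + y b. Testing on b11 isolates y and testing on a22 isolates x. The
  accompanying terms vanish: \<open>ip a1 (A b1)\<close> because a1 and its image lie in the plane
  of a and b, which is orthogonal to b1, and \<open>ip a2 (A a2)\<close> by skewness.\<close>

lemma kills_first:
  assumes "A a \<in> span {a, b}"
    and "ip a1 (A b1) + ip a (A b11) = 0" "ip a2 (A a2) + ip a (A a22) = 0"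
    and "A b \<in> span {a, b}"
  shows "A a = 0"
proof -
  obtain x y where xy: "A a = x *\<^sub>R a + y *\<^sub>R b" using assms mem_span by blast
  obtain x' y' where xy': "A b = x' *\<^sub>R a + y' *\<^sub>R b" using assms mem_span by blast
  obtain p q where pq: "a1 = p *\<^sub>R a + q *\<^sub>R b" using kernel mem_span by blast
  have "ip a1 (A b1) = 0"
    by (simp add: pq ip.add_left ip.scaleR_left skew xy xy' contact linear_add[OF lin] linear_scale[OF lin])
  moreover have "ip a (A b11) = y * ip b1 b1"
    by (simp add: skew xy ip.add_left ip.scaleR_left second)
  ultimately have y: "y = 0" using assms middle by simp
  have "ip a (A a22) = x * ip a2 a2"
    by (simp add: skew xy ip.add_left ip.scaleR_left second)
  then have "x = 0" using assms middle skew_diag by simp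
  then show ?thesis using y xy by simp
qed

text \<open>Write A b1 = x a + y b. In the first condition the terms are -1, 1 and 1 times
  \<open>y * ip b1 b1\<close>, so they do not cancel. In the second only
  \<open>- x * ip a2 a2\<close> survives, since \<open>A a2\<close> lies in the plane and b12 is
  orthogonal to it.\<close>

lemma kills_middle:
  assumes kills: "A a = 0" "A b = 0"
    and "A a2 \<in> span {a, b}" "A b1 \<in> span {a, b}"
    and "ip b11 (A b1) + ip b1 (A b11) + ip b1 (A b11) = 0"
    and "ip a22 (A b1) + ip a2 (A b12) + ip a2 (A b12) = 0"
  shows "A b1 = 0"
proof -
  obtain x y where xy: "A b1 = x *\<^sub>R a + y *\<^sub>R b" using assms mem_span by blast
  obtain x' y' where xy': "A a2 = x' *\<^sub>R a + y' *\<^sub>R b" using assms mem_span by blast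
  have "ip b11 (A b1) = - y * ip b1 b1" "ip b1 (A b11) = y * ip b1 b1"
    by (simp_all add: skew xy ip.add_left ip.scaleR_left second ip.add_right ip.scaleR_right ip_commute[of b11])
  then have y: "y = 0" using assms middle by simp
  have "ip a22 (A b1) = - x * ip a2 a2" "ip a2 (A b12) = 0"
    by (simp_all add: skew xy xy' ip.add_left ip.scaleR_left second ip.add_right ip.scaleR_right ip_commute[of a22])
  then have "x = 0" using assms middle by simp
  then show ?thesis using y xy by simp
qed

text \<open>On the rank 2 quotient spanned by a2 and b1 a skew map has the single component
  \<open>ip a2 (A b1)\<close>, and the condition kills it. Both images are then orthogonal to a, b,
  a2 and b1.\<close>

lemma image_middle:
  assumes kills: "A a = 0" "A b = 0" and "ip a2 (A b1) + ip a (A b12) = 0"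
  shows "A a2 \<in> span {a, b}" "A b1 \<in> span {a, b}"
proof -
  have "ip a2 (A b1) = 0"
    using assms by (simp add: skew ip.zero_left)
  then show "A a2 \<in> span {a, b}" "A b1 \<in> span {a, b}"
    using kills skew_diag[of a2] skew_diag[of b1] skew[of a2 b1]
    by (auto intro!: maximal simp: ip_commute[of "A _"] skew[of a] skew[of b] ip.zero_left)
qed

lemma kills_perp:
  assumes kills: "A a = 0" "A b = 0" "A a2 = 0" "A b1 = 0" and v: "ip v a = 0" "ip v b = 0"
  shows "A v = 0"
proof -
  \<comment> \<open>Removes the projections to the orthogonal non-null vectors a2 and b1; the rest
    is in the plane of a and b.\<close>
  define v' where "v' = v - (ip v a2 / ip a2 a2) *\<^sub>R a2 - (ip v b1 / ip b1 b1) *\<^sub>R b1"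
  have "v' \<in> span {a, b}"
    by (rule maximal) (use v contact middle in \<open>auto simp: v'_def ip.diff_left ip.scaleR_left ip_commute[of a2 a]
        ip_commute[of b1 a] ip_commute[of a2 b] ip_commute[of b1 b] ip_commute[of b1 a2]\<close>)
  then obtain x y where xy: "v' = x *\<^sub>R a + y *\<^sub>R b" using mem_span by blast
  have "v = v' + (ip v a2 / ip a2 a2) *\<^sub>R a2 + (ip v b1 / ip b1 b1) *\<^sub>R b1"
    by (simp add: v'_def)
  then have "A v = A (x *\<^sub>R a + y *\<^sub>R b + (ip v a2 / ip a2 a2) *\<^sub>R a2 + (ip v b1 / ip b1 b1) *\<^sub>R b1)"
    unfolding xy by metis
  then show ?thesis
    by (simp add: linear_add[OF lin] linear_scale[OF lin] kills)
qed

text \<open>Vanishing on a, b, a2 and b1 forces the image into the plane of a and b. By skewness,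
  \<open>A a22 = 0\<close> makes every image orthogonal to a22, which removes the a coefficient. The
  b coefficient goes the same way through b11, once skewness has given
  \<open>A b11 = 0\<close>.\<close>

lemma kills_all:
  assumes kills: "A a = 0" "A b = 0" "A a2 = 0" "A b1 = 0" "A a22 = 0"
  shows "A w = 0"
proof -
  have image: "\<exists>x y. A w = x *\<^sub>R a + y *\<^sub>R b" for w
    by (rule mem_span[THEN iffD1], rule maximal)
      (simp_all add: kills ip_commute[of "A w"] skew[of a] skew[of b] skew[of a2] skew[of b1] ip.zero_left)
  have x: "x = 0" if "A w = x *\<^sub>R a + y *\<^sub>R b" for w x y
  proof -
    have "ip a22 (A w) = 0" by (simp add: skew[of a22] kills ip.zero_left)
    then show ?thesis
      using middle second by (simp add: that ip.add_right ip.scaleR_right ip_commute[of a22])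
  qed
  have b11: "A b11 = 0"
  proof -
    obtain x y where xy: "A b11 = x *\<^sub>R a + y *\<^sub>R b" using image by blast
    have "y = 0"
      using middle second skew_diag[of b11] by (simp add: xy ip.add_right ip.scaleR_right ip_commute[of b11])
    then show ?thesis using x[OF xy] xy by simp
  qed
  obtain x y where xy: "A w = x *\<^sub>R a + y *\<^sub>R b" using image by blast
  have "ip b11 (A w) = 0" by (simp add: skew[of b11] b11 ip.zero_left)
  then have "y = 0"
    using middle second by (simp add: xy ip.add_right ip.scaleR_right ip_commute[of b11])
  then show ?thesis using x[OF xy] xy by simp
qed

end

section \<open>Bivectors and the line of a plane\<close>

lemma wedge_bilinear: "bounded_bilinear (wedge :: real^'n \<Rightarrow> real^'n \<Rightarrow> real^'n^'n)"
proof -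
  have "bilinear (wedge :: real^'n \<Rightarrow> real^'n \<Rightarrow> real^'n^'n)"
    unfolding bilinear_def by (auto intro!: linearI simp: wedge_def vec_eq_iff algebra_simps)
  then show ?thesis by (simp add: bilinear_conv_bounded_bilinear)
qed

lemma wedge_self [simp]: "wedge v v = 0"
  by (simp add: wedge_def vec_eq_iff)

lemma wedge_swap: "wedge w v = - wedge v w"
  by (simp add: wedge_def vec_eq_iff)

lemma wedge_comb: "wedge (x *\<^sub>R a + y *\<^sub>R b) (z *\<^sub>R a + w *\<^sub>R b) = (x * w - y * z) *\<^sub>R wedge a b"
  by (simp add: wedge_def vec_eq_iff algebra_simps)

lemma wedge_eq_0_imp:
  assumes "wedge a b = 0" "a \<noteq> 0"
  shows "\<exists>c. b = c *\<^sub>R a"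
proof -
  obtain i where i: "a $ i \<noteq> 0" using assms by (auto simp: vec_eq_iff)
  have "a $ i * b $ j = b $ i * a $ j" for j
    using assms(1) by (auto simp: wedge_def vec_eq_iff dest: spec[of _ i] spec[of _ j])
  then have "b = (b $ i / a $ i) *\<^sub>R a" using i by (simp add: vec_eq_iff field_simps)
  then show ?thesis ..
qed

lemma wedge_nonzero_iff_dim: "wedge a b \<noteq> 0 \<longleftrightarrow> dim (span {a, b}) = 2"
proof
  assume w: "wedge a b \<noteq> 0"
  then have b: "b \<noteq> 0"
    by (auto simp: bounded_bilinear.zero_right[OF wedge_bilinear])
  have "a \<notin> span {b}"
    using w by (auto simp: span_singleton bounded_bilinear.scaleR_left[OF wedge_bilinear])
  then show "dim (span {a, b}) = 2"
    using b by (simp add: dim_insert span_singleton)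
next
  assume d: "dim (span {a, b}) = 2"
  have "dim {a, b} \<le> 1" if w: "wedge a b = 0"
  proof (cases "a = 0")
    case True
    then show ?thesis by (simp add: dim_insert span_0)
  next
    case False
    then obtain c where "b = c *\<^sub>R a" using wedge_eq_0_imp[OF w] by blast
    then have "b \<in> span {a}" by (auto simp: span_singleton)
    then have "dim {b, a} \<le> 1" by (simp add: dim_insert[of b])
    then show ?thesis by (simp add: insert_commute)
  qed
  then show "wedge a b \<noteq> 0" using d by auto
qed

lemma wedge2_span: "wedge2 (span {a, b}) = span {wedge a b}"
proof
  have "wedge v w \<in> span {wedge a b}" if "v \<in> span {a, b}" "w \<in> span {a, b}" for v w
    using that by (auto simp: span_pair wedge_comb span_singleton)
  then show "wedge2 (span {a, b}) \<subseteq> span {wedge a b}"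
    unfolding wedge2_def by (intro span_minimal) auto
  have "{wedge a b} \<subseteq> {wedge v w |v w. v \<in> span {a, b} \<and> w \<in> span {a, b}}"
    by (auto intro: span_base)
  then show "span {wedge a b} \<subseteq> wedge2 (span {a, b})"
    unfolding wedge2_def by (rule span_mono)
qed

section \<open>Jets along the diagonal and the Maurer-Cartan form\<close>

lemma bounded_bilinear_matrix_vector_mult:
  "bounded_bilinear (\<lambda>(M::real^'n^'m) v. M *v v)"
proof -
  have "bilinear (\<lambda>(M::real^'n^'m) v. M *v v)"
    unfolding bilinear_def
    by (auto intro!: linearI simp: matrix_vector_mult_def vec_eq_iff algebra_simps sum.distrib sum_distrib_left)
  then show ?thesis by (simp add: bilinear_conv_bounded_bilinear)
qed

text \<open>Exhibits \<open>ip u (M *v v)\<close> as an inner product of M with something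
  independent of M (\<open>ip_matrix_outer\<close>), the form in which the matrix can be
  differentiated separately from the vectors.\<close>

definition outer :: "real^'n \<Rightarrow> real^'m \<Rightarrow> real^'m^'n" where
  "outer u v = (\<chi> i j. u $ i * v $ j)"

lemma bounded_bilinear_outer: "bounded_bilinear (outer :: real^'n \<Rightarrow> real^'m \<Rightarrow> real^'m^'n)"
proof -
  have "bilinear (outer :: real^'n \<Rightarrow> real^'m \<Rightarrow> real^'m^'n)"
    unfolding bilinear_def by (auto intro!: linearI simp: outer_def vec_eq_iff algebra_simps)
  then show ?thesis by (simp add: bilinear_conv_bounded_bilinear)
qed

lemma inner_outer: "M \<bullet> outer u v = u \<bullet> (M *v v)"
  by (simp add: outer_def inner_vec_def matrix_vector_mult_def sum_distrib_left mult_ac)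

lemma ip_matrix_outer: "ip u (M *v v) = M \<bullet> outer (flip u) v"
  by (simp add: inner_outer ip_flip)

lemmas dd_matrix_vector = dd_bilinear[OF bounded_bilinear_matrix_vector_mult]

lemma dd_locally_const:
  assumes "open U" "x \<in> U" "\<And>y. y \<in> U \<Longrightarrow> h y = c"
  shows "dd v h x = 0"
  using frechet_derivative_cong_open[OF assms(1,2), of h "\<lambda>_. c"] assms(3) by (simp add: dd_def)

text \<open>Differentiating the condition at \<open>x\<close> also in \<open>x\<close> costs one order, but replaces \<open>G\<close> by its
  derivative.\<close>

lemma diagonal_jet:
  fixes G \<Theta> :: "'a::real_normed_vector \<Rightarrow> 'b::real_inner"
  assumes V: "open V" "smooth_on G V"
    and "smooth_on \<Theta> V" "\<And>x. x \<in> V \<Longrightarrow> zero_jet (Suc k) (\<lambda>q. G x \<bullet> \<Theta> q) x" "x \<in> V"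
  shows "zero_jet k (\<lambda>q. dd Z G x \<bullet> \<Theta> q) x"
proof -
  have dl: "dd v (\<lambda>q. c \<bullet> \<Psi> q) y = c \<bullet> dd v \<Psi> y" if "smooth_on \<Psi> V" "y \<in> V" for v c y and \<Psi> :: "'a \<Rightarrow> 'b"
    by (rule dd_bounded_linear[OF bounded_linear_inner_right smooth_on_differentiable[OF that]])
  \<comment> \<open>The function \<open>G y \<bullet> \<Psi> y\<close> is zero on V. Its derivative
    splits into the wanted term and \<open>G x \<bullet> dd Z \<Psi> x\<close>, which the first
    order of the jet condition kills.\<close>
  have base: "dd Z G x \<bullet> \<Psi> x = 0"
    if \<Psi>: "smooth_on \<Psi> V" and z: "\<And>x. x \<in> V \<Longrightarrow> zero_jet (Suc k) (\<lambda>q. G x \<bullet> \<Psi> q) x" and x: "x \<in> V"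
    for \<Psi> :: "'a \<Rightarrow> 'b" and x k
  proof -
    have "dd Z (\<lambda>y. G y \<bullet> \<Psi> y) x = 0"
      using z by (intro dd_locally_const[OF V(1) x]) auto
    moreover have "dd Z (\<lambda>y. G y \<bullet> \<Psi> y) x = G x \<bullet> dd Z \<Psi> x + dd Z G x \<bullet> \<Psi> x"
      by (intro dd_bilinear[OF bounded_bilinear_inner] smooth_on_differentiable[OF V(2) x]
          smooth_on_differentiable[OF \<Psi> x])
    moreover have "zero_jet k (dd Z (\<lambda>q. G x \<bullet> \<Psi> q)) x"
      using z[OF x] by simp
    then have "G x \<bullet> dd Z \<Psi> x = 0"
      using dl[OF \<Psi> x] by (cases k) auto
    ultimately show ?thesis by simp
  qed
  show ?thesis
    using assms(3-5)
  proof (induction k arbitrary: \<Theta> x)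
    case 0
    then show ?case using base[of \<Theta> 0 x] by simp
  next
    case (Suc k)
    have "zero_jet k (dd v (\<lambda>q. dd Z G x \<bullet> \<Theta> q)) x" for v
    proof (rule zero_jet_cong[OF V(1) Suc.prems(3)])
      \<comment> \<open>With the base point fixed, a derivative in q falls on
        \<open>\<Theta>\<close> alone, so \<open>dd v \<Theta>\<close> inherits the hypothesis one
        order lower.\<close>
      show "zero_jet k (\<lambda>q. dd Z G x \<bullet> dd v \<Theta> q) x"
      proof (rule Suc.IH[OF smooth_on_dd[OF Suc.prems(1)] _ Suc.prems(3)])
        fix y assume y: "y \<in> V"
        have "zero_jet (Suc k) (dd v (\<lambda>q. G y \<bullet> \<Theta> q)) y"
          using Suc.prems(2)[OF y] by (simp del: zero_jet.simps(2) add: zero_jet.simps(2)[of "Suc k"])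
        then show "zero_jet (Suc k) (\<lambda>q. G y \<bullet> dd v \<Theta> q) y"
          by (rule zero_jet_cong[OF V(1) y, rotated]) (rule dl[OF Suc.prems(1)])
      qed
    qed (simp add: dl[OF Suc.prems(1)])
    then show ?case using base[OF Suc.prems] by (auto simp del: zero_jet.simps(2) simp: zero_jet.simps(2)[of k])
  qed
qed

text \<open>Leibniz expansion of a vanishing 2-jet into identities at the single point x, as the
  algebra of adapted frames requires.\<close>

lemma zero_jet_2_bilinear:
  assumes "bounded_bilinear B" "open U" "smooth_on P U" "smooth_on N U" "x \<in> U"
    "zero_jet 2 (\<lambda>q. B (P q) (N q)) x"
  shows "B (P x) (N x) = 0"
    "B (dd c P x) (N x) + B (P x) (dd c N x) = 0"
    "B (dd b (dd c P) x) (N x) + B (dd c P x) (dd b N x) + B (dd b P x) (dd c N x) + B (P x) (dd b (dd c N) x) = 0"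
proof -
  have d: "dd v (\<lambda>q. B (F q) (H q)) y = B (F y) (dd v H y) + B (dd v F y) (H y)"
    if "smooth_on F U" "smooth_on H U" "y \<in> U" for v F H y
    by (intro dd_bilinear[OF assms(1)] smooth_on_differentiable[OF that(1,3)] smooth_on_differentiable[OF that(2,3)])
  have z: "B (P x) (N x) = 0" "\<And>v. dd v (\<lambda>q. B (P q) (N q)) x = 0"
    "\<And>v w. dd w (dd v (\<lambda>q. B (P q) (N q))) x = 0"
    using assms(6) by (auto simp: numeral_2_eq_2)
  show "B (P x) (N x) = 0" by (rule z)
  show "B (dd c P x) (N x) + B (P x) (dd c N x) = 0"
    using z(2)[of c] d[OF assms(3-5)] by (simp add: add.commute)
  have "dd b (dd c (\<lambda>q. B (P q) (N q))) x = dd b (\<lambda>q. B (P q) (dd c N q) + B (dd c P q) (N q)) x"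
    using frechet_derivative_cong_open[OF assms(2,5), of "dd c (\<lambda>q. B (P q) (N q))"
        "\<lambda>q. B (P q) (dd c N q) + B (dd c P q) (N q)"] d[OF assms(3,4)]
    unfolding dd_def[of b] by simp
  also have "\<dots> = dd b (\<lambda>q. B (P q) (dd c N q)) x + dd b (\<lambda>q. B (dd c P q) (N q)) x"
    by (intro dd_add smooth_on_differentiable[OF _ assms(5)] smooth_on_bilinear[OF assms(1,2)] smooth_on_dd assms(3,4))
  also have "\<dots> = B (P x) (dd b (dd c N) x) + B (dd b P x) (dd c N x) +
      (B (dd c P x) (dd b N x) + B (dd b (dd c P) x) (N x))"
    by (simp only: d[OF assms(3) smooth_on_dd[OF assms(4)] assms(5)] d[OF smooth_on_dd[OF assms(3)] assms(4,5)])
  finally show "B (dd b (dd c P) x) (N x) + B (dd c P x) (dd b N x) + B (dd b P x) (dd c N x) + B (P x) (dd b (dd c N) x) = 0"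
    using z(3)[of b c] by (simp add: add_ac)
qed

section \<open>Legendre maps on an open set of the plane\<close>

text \<open>The contact condition is attached to each section, because on the surface it is assumed
  for global sections, and their restrictions to a chart carry it along.\<close>

definition sections_on ::
    "(real^2) set \<Rightarrow> (real^2 \<Rightarrow> (real^('s::finite + 't::finite)) set) \<Rightarrow> (real^2 \<Rightarrow> real^('s + 't)) set" where
  "sections_on U f = {\<sigma>. smooth_on \<sigma> U \<and> (\<forall>x\<in>U. \<sigma> x \<in> f x \<and> (\<forall>v. dd v \<sigma> x \<in> perp (f x)))}"

text \<open>X and Y are null directions with kernels spanned by \<open>\<sigma> x\<close> and
  \<open>\<tau> x\<close>. The last clause says that X + Y is not null; with the kernel clauses it
  makes \<open>dd Y \<sigma> x\<close> and \<open>dd X \<tau> x\<close> independent modulo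
  L.\<close>

definition adapted_at ::
    "(real^('s::finite + 't::finite)) set \<Rightarrow> real^2 \<Rightarrow> (real^2 \<Rightarrow> real^('s + 't)) \<Rightarrow> (real^2 \<Rightarrow> real^('s + 't)) \<Rightarrow>
      real^2 \<Rightarrow> real^2 \<Rightarrow> bool" where
  "adapted_at L x \<sigma> \<tau> X Y \<longleftrightarrow> wedge (\<sigma> x) (\<tau> x) \<noteq> 0 \<and> (\<forall>Z. \<exists>r s. Z = r *\<^sub>R X + s *\<^sub>R Y) \<and>
     dd X \<sigma> x \<in> L \<and> dd Y \<tau> x \<in> L \<and>
     (\<forall>c d. c *\<^sub>R dd (X + Y) \<sigma> x + d *\<^sub>R dd (X + Y) \<tau> x \<in> L \<longrightarrow> c = 0 \<and> d = 0)"

text \<open>Both signatures enter through the total dimension 6, which makes the quotient of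
  \<open>perp (f x)\<close> by \<open>f x\<close> a plane.\<close>

locale legendre_chart =
  fixes U :: "(real^2) set" and f :: "real^2 \<Rightarrow> (real^('s::finite + 't::finite)) set"
  assumes open_U: "open U"
    and null_plane: "x \<in> U \<Longrightarrow> f x \<in> null_planes"
    and dim_total: "CARD('s) + CARD('t) = 6"
    and adapted_ex: "x \<in> U \<Longrightarrow> \<exists>\<sigma>\<in>sections_on U f. \<exists>\<tau>\<in>sections_on U f. \<exists>X Y. adapted_at (f x) x \<sigma> \<tau> X Y"
begin

abbreviation "S \<equiv> sections_on U f"

lemma section_smooth: "\<sigma> \<in> S \<Longrightarrow> smooth_on \<sigma> U"
  and section_mem: "\<sigma> \<in> S \<Longrightarrow> x \<in> U \<Longrightarrow> \<sigma> x \<in> f x"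
  and section_dd_perp: "\<sigma> \<in> S \<Longrightarrow> x \<in> U \<Longrightarrow> dd v \<sigma> x \<in> perp (f x)"
  by (auto simp: sections_on_def)

lemma fibre_subset_perp: "x \<in> U \<Longrightarrow> f x \<subseteq> perp (f x)"
  using null_plane[of x] by (auto simp: null_planes_def perp_def)

lemma fibre_span:
  assumes "\<sigma> \<in> S" "\<tau> \<in> S" "x \<in> U" "wedge (\<sigma> x) (\<tau> x) \<noteq> 0"
  shows "f x = span {\<sigma> x, \<tau> x}"
proof -
  have "dim (f x) = 2" "subspace (f x)"
    using null_plane assms by (auto simp: null_planes_def)
  moreover have "dim (span {\<sigma> x, \<tau> x}) = 2"
    using assms wedge_nonzero_iff_dim by blast
  moreover have "span {\<sigma> x, \<tau> x} \<subseteq> f x"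
    using assms section_mem \<open>subspace (f x)\<close> by (intro span_minimal) auto
  ultimately show ?thesis
    by (metis order_refl subspace_dim_equal subspace_span)
qed

lemma contact: "\<sigma> \<in> S \<Longrightarrow> \<tau> \<in> S \<Longrightarrow> x \<in> U \<Longrightarrow> ip (\<sigma> x) (dd X \<tau> x) = 0"
  using section_dd_perp[of \<tau> x X] section_mem[of \<sigma> x] by (auto simp: perp_def ip_commute)

text \<open>Derivative of the contact identity. It is the source of all the assumptions
  \<open>second\<close> of an adapted frame.\<close>

lemma contact_dd:
  assumes "\<sigma> \<in> S" "\<tau> \<in> S" "x \<in> U"
  shows "ip (\<sigma> x) (dd Z (dd X \<tau>) x) = - ip (dd Z \<sigma> x) (dd X \<tau> x)"
proof -
  have "dd Z (\<lambda>y. ip (\<sigma> y) (dd X \<tau> y)) x = 0"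
    using assms contact by (intro dd_locally_const[OF open_U]) auto
  moreover have "dd Z (\<lambda>y. ip (\<sigma> y) (dd X \<tau> y)) x = ip (\<sigma> x) (dd Z (dd X \<tau>) x) + ip (dd Z \<sigma> x) (dd X \<tau> x)"
    by (intro dd_bilinear[OF bounded_bilinear_ip] smooth_on_differentiable[OF _ assms(3)] smooth_on_dd
        section_smooth assms(1,2))
  ultimately show ?thesis by simp
qed

text \<open>A dimension count shows that the plane and its two nontrivial derivatives span the
  4-dimensional \<open>perp (f x)\<close>; \<open>perp_perp\<close> then gives
  \<open>maximal\<close>, from which the two derivatives are seen to be non-null.\<close>

lemma adapted_frame_at:
  assumes st: "\<sigma> \<in> S" "\<tau> \<in> S" and x: "x \<in> U" and ad: "adapted_at (f x) x \<sigma> \<tau> X Y"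
  shows "adapted_frame (\<sigma> x) (\<tau> x) (dd X \<sigma> x) (dd Y \<sigma> x) (dd X \<tau> x) (dd Y \<tau> x)
     (dd X (dd X \<sigma>) x) (dd X (dd Y \<sigma>) x) (dd Y (dd Y \<sigma>) x)
     (dd X (dd X \<tau>) x) (dd X (dd Y \<tau>) x) (dd Y (dd Y \<tau>) x)"
proof -
  have w: "wedge (\<sigma> x) (\<tau> x) \<noteq> 0" and kX: "dd X \<sigma> x \<in> f x" and kY: "dd Y \<tau> x \<in> f x"
    and inj: "\<And>c d. c *\<^sub>R dd (X + Y) \<sigma> x + d *\<^sub>R dd (X + Y) \<tau> x \<in> f x \<Longrightarrow> c = 0 \<and> d = 0"
    using ad by (auto simp: adapted_at_def)
  have sub: "subspace (f x)" "dim (f x) = 2"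
    using null_plane x by (auto simp: null_planes_def)
  have fx: "f x = span {\<sigma> x, \<tau> x}" by (rule fibre_span[OF st x w])
  have add: "dd (X + Y) \<rho> x = dd X \<rho> x + dd Y \<rho> x" if "\<rho> \<in> S" for \<rho>
    using linear_add[OF linear_dd[OF smooth_on_differentiable[OF section_smooth[OF that] x]]] .
  \<comment> \<open>The derivatives \<open>dd X \<sigma> x\<close> and \<open>dd Y \<tau> x\<close>
    lie in the fibre and can be added freely.\<close>
  have inj': "c = 0 \<and> d = 0" if "c *\<^sub>R dd Y \<sigma> x + d *\<^sub>R dd X \<tau> x \<in> f x" for c d
  proof (rule inj)
    have "(c *\<^sub>R dd Y \<sigma> x + d *\<^sub>R dd X \<tau> x) + (c *\<^sub>R dd X \<sigma> x + d *\<^sub>R dd Y \<tau> x) \<in> f x"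
      using subspace_add[OF sub(1) that subspace_add[OF sub(1) subspace_scale[OF sub(1) kX, of c] subspace_scale[OF sub(1) kY, of d]]] .
    then show "c *\<^sub>R dd (X + Y) \<sigma> x + d *\<^sub>R dd (X + Y) \<tau> x \<in> f x"
      by (simp add: add st algebra_simps)
  qed
  have perp: "\<And>\<rho> v. \<rho> \<in> S \<Longrightarrow> dd v \<rho> x \<in> perp (f x)" using section_dd_perp x by blast
  have ort: "ip (dd X \<sigma> x) (dd v \<rho> x) = 0" "ip (dd Y \<tau> x) (dd v \<rho> x) = 0"
    "ip (dd v \<rho> x) (dd X \<sigma> x) = 0" "ip (dd v \<rho> x) (dd Y \<tau> x) = 0" if "\<rho> \<in> S" for \<rho> v
    using perp[OF that, of v] kX kY by (auto simp: perp_def ip_commute)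
  have comm: "dd Y (dd X \<rho>) x = dd X (dd Y \<rho>) x" if "\<rho> \<in> S" for \<rho>
    by (rule dd_commute[OF open_U section_smooth[OF that] x])
  \<comment> \<open>By \<open>contact_dd\<close> this is, up to sign, a pairing of
    \<open>\<sigma> x\<close> with a mixed derivative of \<open>\<tau>\<close>; in the other order
    of differentiation that pairing involves kernel vectors and vanishes.\<close>
  have mid: "ip (dd Y \<sigma> x) (dd X \<tau> x) = 0"
    using contact_dd[OF st x, of Y X] contact_dd[OF st x, of X Y] comm[OF st(2)] ort st by simp
  have spanp: "perp (f x) = span {dd X \<tau> x, dd Y \<sigma> x, \<sigma> x, \<tau> x}"
  proof -
    have 1: "dd Y \<sigma> x \<notin> span {\<sigma> x, \<tau> x}"
      using inj'[of 1 0] by (auto simp: fx)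
    have 2: "dd X \<tau> x \<notin> span {dd Y \<sigma> x, \<sigma> x, \<tau> x}"
    proof
      assume "dd X \<tau> x \<in> span {dd Y \<sigma> x, \<sigma> x, \<tau> x}"
      then obtain k where "dd X \<tau> x - k *\<^sub>R dd Y \<sigma> x \<in> f x"
        unfolding fx span_insert[of "dd Y \<sigma> x"] by auto
      then show False using inj'[of "- k" 1] by simp
    qed
    have "dim {dd X \<tau> x, dd Y \<sigma> x, \<sigma> x, \<tau> x} = 4"
      using 1 2 sub(2) by (simp add: fx dim_insert[of "dd X \<tau> x"] dim_insert[of "dd Y \<sigma> x"])
    moreover have "dim (perp (f x)) = 4"
      using dim_perp[OF sub(1)] sub(2) dim_total by simp
    moreover have "span {dd X \<tau> x, dd Y \<sigma> x, \<sigma> x, \<tau> x} \<subseteq> perp (f x)"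
      using perp st section_mem fibre_subset_perp x by (intro span_minimal subspace_perp) blast
    ultimately show ?thesis
      by (metis dim_span order_refl subspace_dim_equal subspace_perp subspace_span)
  qed
  have maximal: "v \<in> f x"
    if "ip v (\<sigma> x) = 0" "ip v (\<tau> x) = 0" "ip v (dd Y \<sigma> x) = 0" "ip v (dd X \<tau> x) = 0" for v
  proof -
    have "v \<in> perp (perp (f x))"
      unfolding spanp by (simp add: mem_perp_span that)
    then show ?thesis using perp_perp[OF sub(1)] by simp
  qed
  have cn: "ip (dd v \<rho> x) (\<sigma> x) = 0" "ip (dd v \<rho> x) (\<tau> x) = 0" if "\<rho> \<in> S" for v \<rho>
    using contact that st x by (simp_all add: ip_commute[of "dd v \<rho> x"])
  \<comment> \<open>If it were null, it would be orthogonal to all of \<open>perp (f x)\<close> and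
    so lie in the fibre, against \<open>inj'\<close>.\<close>
  have nz: "ip (dd Y \<sigma> x) (dd Y \<sigma> x) \<noteq> 0"
    using maximal[OF cn(1)[OF st(1)] cn(2)[OF st(1)] _ mid] inj'[of 1 0] by auto
  have mid': "ip (dd X \<tau> x) (dd Y \<sigma> x) = 0"
    using mid by (simp add: ip_commute)
  have nz': "ip (dd X \<tau> x) (dd X \<tau> x) \<noteq> 0"
    using maximal[OF cn(1)[OF st(2)] cn(2)[OF st(2)] mid'] inj'[of 0 1] by auto
  have null: "ip u v = 0" if "u \<in> f x" "v \<in> f x" for u v
    using null_plane[OF x] that by (auto simp: null_planes_def)
  show ?thesis
  proof unfold_locales
    show "v \<in> span {\<sigma> x, \<tau> x}"
      if "ip v (\<sigma> x) = 0" "ip v (\<tau> x) = 0" "ip v (dd Y \<sigma> x) = 0" "ip v (dd X \<tau> x) = 0" for v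
      using maximal[OF that] fx by simp
  qed (simp_all add: null section_mem contact contact_dd st x kX kY mid mid' nz nz' ort fx[symmetric])
qed

end

text \<open>The assumption \<open>contact3\<close> expresses that \<open>G\<^sup>-\<^sup>1(x) G(q) \<sigma>(q)\<close> stays in \<open>f(q)\<close> to third order at
  \<open>q = x\<close>, by pairing with sections \<open>\<nu>\<close> of the bundle \<open>perp f\<close>; so no choice of scale in the
  projective space enters.\<close>

locale contact_chart = legendre_chart U f
  for U :: "(real^2) set" and f :: "real^2 \<Rightarrow> (real^('s::finite + 't::finite)) set" +
  fixes G :: "real^2 \<Rightarrow> real^('s + 't)^('s + 't)"
  assumes smooth_G: "smooth_on G U" and G_Ogroup: "x \<in> U \<Longrightarrow> G x \<in> Ogroup"
    and contact3: "\<sigma> \<in> S \<Longrightarrow> \<tau> \<in> S \<Longrightarrow> x \<in> U \<Longrightarrow> wedge (\<sigma> x) (\<tau> x) \<noteq> 0 \<Longrightarrow> smooth_on \<nu> U \<Longrightarrow>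
      (\<And>y. y \<in> U \<Longrightarrow> \<nu> y \<in> perp (f y)) \<Longrightarrow> zero_jet 3 (\<lambda>q. ip (G q *v \<sigma> q) (G x *v \<nu> q)) x"
begin

text \<open>The Maurer-Cartan form \<open>G\<^sup>-\<^sup>1 dG\<close>.\<close>

definition \<alpha> :: "real^2 \<Rightarrow> real^2 \<Rightarrow> real^('s + 't) \<Rightarrow> real^('s + 't)" where
  "\<alpha> x Z v = matrix_inv (G x) *v (dd Z G x *v v)"

lemma G_\<alpha>: "x \<in> U \<Longrightarrow> dd Z G x *v v = G x *v \<alpha> x Z v"
  using matrix_inv_mult(1)[OF Ogroup_invertible[OF G_Ogroup]]
  by (simp add: \<alpha>_def matrix_vector_mul_assoc matrix_mul_assoc)

lemma ip_G: "x \<in> U \<Longrightarrow> ip (G x *v u) (G x *v v) = ip u v"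
  by (rule Ogroup_ip[OF G_Ogroup])

lemma \<alpha>_eq_0_iff: "x \<in> U \<Longrightarrow> \<alpha> x Z v = 0 \<longleftrightarrow> dd Z G x *v v = 0"
  using G_\<alpha>[of x Z v] \<alpha>_def[of x Z v] by (metis matrix_vector_mult_0_right)

text \<open>Differentiate \<open>ip (G y *v u) (G y *v v)\<close>, which is constant in y.\<close>

lemma skew_\<alpha>:
  assumes x: "x \<in> U"
  shows "skew_map (\<alpha> x Z)"
proof
  show "\<alpha> x Z (u + v) = \<alpha> x Z u + \<alpha> x Z v" "\<alpha> x Z (c *\<^sub>R u) = c *\<^sub>R \<alpha> x Z u" for u v c
    by (simp_all add: \<alpha>_def matrix_vector_right_distrib
        bounded_bilinear.scaleR_right[OF bounded_bilinear_matrix_vector_mult])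
  fix u v
  have dG: "G differentiable (at x)" by (rule smooth_on_differentiable[OF smooth_G x])
  have d: "dd Z (\<lambda>y. G y *v w) x = dd Z G x *v w" and d': "(\<lambda>y. G y *v w) differentiable (at x)" for w
  proof -
    have bl: "bounded_linear (\<lambda>M::real^('s+'t)^('s+'t). M *v w)"
      by (rule bounded_bilinear.bounded_linear_left[OF bounded_bilinear_matrix_vector_mult])
    show "dd Z (\<lambda>y. G y *v w) x = dd Z G x *v w"
      by (rule dd_bounded_linear[OF bl dG])
    show "(\<lambda>y. G y *v w) differentiable (at x)"
      by (rule differentiableI[OF bounded_linear.has_derivative[OF bl dd_works[OF dG]]])
  qed
  have "dd Z (\<lambda>y. ip (G y *v u) (G y *v v)) x = 0"
    using ip_G by (intro dd_locally_const[OF open_U x]) auto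
  then have "ip (G x *v u) (dd Z G x *v v) + ip (dd Z G x *v u) (G x *v v) = 0"
    using dd_bilinear[OF bounded_bilinear_ip d'[of u] d'[of v], of Z] by (simp add: d)
  then show "ip u (\<alpha> x Z v) = - ip (\<alpha> x Z u) v"
    by (simp add: G_\<alpha> x ip_G)
qed

lemma smooth_G_vec: "smooth_on \<nu> U \<Longrightarrow> smooth_on (\<lambda>q. G q *v \<nu> q) U"
  by (rule smooth_on_bilinear[OF bounded_bilinear_matrix_vector_mult open_U smooth_G])

text \<open>The hypothesis \<open>contact3\<close> holds at every base point of an open set, so
  \<open>diagonal_jet\<close> may differentiate in the base point; order 3 drops to 2.\<close>

lemma twisted_contact:
  assumes "\<sigma> \<in> S" "\<tau> \<in> S" "x \<in> U" "wedge (\<sigma> x) (\<tau> x) \<noteq> 0" "smooth_on \<nu> U"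
    "\<And>y. y \<in> U \<Longrightarrow> \<nu> y \<in> perp (f y)"
  shows "zero_jet 2 (\<lambda>q. ip (G q *v \<sigma> q) (dd Z G x *v \<nu> q)) x"
proof -
  \<comment> \<open>The base points where the two sections still frame f, as \<open>contact3\<close>
    demands.\<close>
  define V where "V = {y \<in> U. wedge (\<sigma> y) (\<tau> y) \<noteq> 0}"
  have "smooth_on (\<lambda>y. wedge (\<sigma> y) (\<tau> y)) U"
    using assms section_smooth by (intro smooth_on_bilinear[OF wedge_bilinear open_U])
  then have "open (U \<inter> (\<lambda>y. wedge (\<sigma> y) (\<tau> y)) -` (- {0}))"
    by (intro continuous_open_preimage smooth_on_continuous_on open_U) auto
  then have V: "open V" "V \<subseteq> U"
    by (auto simp: V_def vimage_def Int_def)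
  have bl: "bounded_linear (flip :: real^('s+'t) \<Rightarrow> _)"
    using linear_flip linear_conv_bounded_linear by blast
  show ?thesis
    unfolding ip_matrix_outer
  proof (rule diagonal_jet[OF V(1) smooth_on_subset[OF smooth_G V(2)]])
    show "smooth_on (\<lambda>q. outer (flip (G q *v \<sigma> q)) (\<nu> q)) V"
      by (intro smooth_on_subset[OF _ V(2)] smooth_on_bilinear[OF bounded_bilinear_outer open_U]
          smooth_on_bounded_linear[OF bl open_U] smooth_G_vec section_smooth assms)
    show "x \<in> V" using assms by (simp add: V_def)
    show "zero_jet (Suc 2) (\<lambda>q. G y \<bullet> outer (flip (G q *v \<sigma> q)) (\<nu> q)) y" if "y \<in> V" for y
      using contact3[OF assms(1,2) _ _ assms(5,6), of y] that
      by (simp add: V_def ip_matrix_outer flip: numeral_3_eq_3 del: zero_jet.simps)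
  qed
qed

text \<open>The numbers count orders of the original 3-jet: these are orders 0, 1, 2 after one was
  spent on Z. In the last one the second derivative of \<open>G q *v \<sigma> q\<close> stays
  unexpanded, since it would bring in derivatives of \<open>\<alpha>\<close>.\<close>

lemma
  assumes "\<sigma> \<in> S" "\<tau> \<in> S" "x \<in> U" "wedge (\<sigma> x) (\<tau> x) \<noteq> 0" "smooth_on \<nu> U"
    "\<And>y. y \<in> U \<Longrightarrow> \<nu> y \<in> perp (f y)"
  shows contact_order_1: "ip (\<sigma> x) (\<alpha> x Z (\<nu> x)) = 0"
    and contact_order_2: "ip (\<alpha> x c (\<sigma> x) + dd c \<sigma> x) (\<alpha> x Z (\<nu> x)) + ip (\<sigma> x) (\<alpha> x Z (dd c \<nu> x)) = 0"
    and contact_order_3: "ip (dd b (dd c (\<lambda>q. G q *v \<sigma> q)) x) (G x *v \<alpha> x Z (\<nu> x)) +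
      ip (dd c (\<lambda>q. G q *v \<sigma> q) x) (G x *v \<alpha> x Z (dd b \<nu> x)) +
      ip (dd b (\<lambda>q. G q *v \<sigma> q) x) (G x *v \<alpha> x Z (dd c \<nu> x)) + ip (\<sigma> x) (\<alpha> x Z (dd b (dd c \<nu>) x)) = 0"
proof -
  have bb: "bounded_bilinear (\<lambda>u v. ip u (dd Z G x *v v))"
    using bounded_bilinear.comp[OF bounded_bilinear_ip bounded_linear_ident matrix_vector_mul_bounded_linear] .
  note T = zero_jet_2_bilinear[OF bb open_U smooth_G_vec[OF section_smooth[OF assms(1)]] assms(5,3)
      twisted_contact[OF assms]]
  have d: "dd c (\<lambda>q. G q *v \<sigma> q) x = G x *v (\<alpha> x c (\<sigma> x) + dd c \<sigma> x)"
    using dd_matrix_vector[OF smooth_on_differentiable[OF smooth_G assms(3)]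
        smooth_on_differentiable[OF section_smooth[OF assms(1)] assms(3)]]
    by (simp add: G_\<alpha> assms(3) matrix_vector_right_distrib)
  show "ip (\<sigma> x) (\<alpha> x Z (\<nu> x)) = 0"
    using T(1) by (simp add: G_\<alpha> ip_G assms(3))
  show "ip (\<alpha> x c (\<sigma> x) + dd c \<sigma> x) (\<alpha> x Z (\<nu> x)) + ip (\<sigma> x) (\<alpha> x Z (dd c \<nu> x)) = 0"
    using T(2)[of c] by (simp only: d G_\<alpha>[OF assms(3)] ip_G[OF assms(3)])
  show "ip (dd b (dd c (\<lambda>q. G q *v \<sigma> q)) x) (G x *v \<alpha> x Z (\<nu> x)) +
      ip (dd c (\<lambda>q. G q *v \<sigma> q) x) (G x *v \<alpha> x Z (dd b \<nu> x)) +
      ip (dd b (\<lambda>q. G q *v \<sigma> q) x) (G x *v \<alpha> x Z (dd c \<nu> x)) + ip (\<sigma> x) (\<alpha> x Z (dd b (dd c \<nu>) x)) = 0"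
    using T(3)[of b c] by (simp only: G_\<alpha>[OF assms(3)] ip_G[OF assms(3)])
qed

lemma perp_field:
  assumes "\<rho> \<in> S"
  shows "smooth_on \<rho> U" "smooth_on (dd v \<rho>) U"
    "y \<in> U \<Longrightarrow> \<rho> y \<in> perp (f y)" "y \<in> U \<Longrightarrow> dd v \<rho> y \<in> perp (f y)"
  using section_smooth[OF assms] smooth_on_dd[OF section_smooth[OF assms]] section_mem[OF assms]
    fibre_subset_perp section_dd_perp[OF assms] by auto

lemma adapted_skew_at:
  assumes "\<sigma> \<in> S" "\<tau> \<in> S" "x \<in> U" "adapted_at (f x) x \<sigma> \<tau> X Y"
  shows "adapted_skew (\<sigma> x) (\<tau> x) (dd X \<sigma> x) (dd Y \<sigma> x) (dd X \<tau> x) (dd Y \<tau> x)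
     (dd X (dd X \<sigma>) x) (dd X (dd Y \<sigma>) x) (dd Y (dd Y \<sigma>) x)
     (dd X (dd X \<tau>) x) (dd X (dd Y \<tau>) x) (dd Y (dd Y \<tau>) x) (\<alpha> x Z)"
  by (intro adapted_skew.intro adapted_frame_at skew_\<alpha> assms)

text \<open>Taking for \<open>\<nu>\<close> the two frame sections and their derivatives makes the
  image of a fibre vector orthogonal to a spanning set of \<open>perp (f x)\<close>.\<close>

lemma \<alpha>_fibre:
  assumes x: "x \<in> U" and v: "v \<in> f x"
  shows "\<alpha> x Z v \<in> f x"
proof -
  obtain \<sigma> \<tau> X Y where st: "\<sigma> \<in> S" "\<tau> \<in> S" and ad: "adapted_at (f x) x \<sigma> \<tau> X Y"
    using adapted_ex[OF x] by blast
  have w: "wedge (\<sigma> x) (\<tau> x) \<noteq> 0" using ad by (simp add: adapted_at_def)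
  then have w': "wedge (\<tau> x) (\<sigma> x) \<noteq> 0" by (simp add: wedge_swap[of "\<tau> x"])
  have fx: "f x = span {\<sigma> x, \<tau> x}" by (rule fibre_span[OF st x w])
  interpret A: adapted_skew "\<sigma> x" "\<tau> x" "dd X \<sigma> x" "dd Y \<sigma> x" "dd X \<tau> x" "dd Y \<tau> x"
     "dd X (dd X \<sigma>) x" "dd X (dd Y \<sigma>) x" "dd Y (dd Y \<sigma>) x"
     "dd X (dd X \<tau>) x" "dd X (dd Y \<tau>) x" "dd Y (dd Y \<tau>) x" "\<alpha> x Z"
    by (rule adapted_skew_at[OF st x ad])
  have 1: "ip (\<alpha> x Z (\<sigma> x)) (\<nu> x) = 0" "ip (\<alpha> x Z (\<tau> x)) (\<nu> x) = 0"
    if "smooth_on \<nu> U" "\<And>y. y \<in> U \<Longrightarrow> \<nu> y \<in> perp (f y)" for \<nu>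
    using contact_order_1[OF st x w that, of Z] contact_order_1[OF st(2,1) x w' that, of Z]
    by (simp_all add: A.skew)
  have 2: "ip (\<alpha> x Z (\<sigma> x)) (\<rho> x) = 0" "ip (\<alpha> x Z (\<tau> x)) (\<rho> x) = 0"
      "ip (\<alpha> x Z (\<sigma> x)) (dd v \<rho> x) = 0" "ip (\<alpha> x Z (\<tau> x)) (dd v \<rho> x) = 0" if "\<rho> \<in> S" for \<rho> v
    using 1[OF perp_field(1,3)[OF that]] 1[OF perp_field(2,4)[OF that]] by auto
  have "\<alpha> x Z (\<sigma> x) \<in> f x" "\<alpha> x Z (\<tau> x) \<in> f x"
    unfolding fx using 2[OF st(1)] 2[OF st(2)] by (blast intro: A.maximal)+
  moreover obtain r s where "v = r *\<^sub>R \<sigma> x + s *\<^sub>R \<tau> x"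
    using v fx A.mem_span by blast
  ultimately show ?thesis
    unfolding fx by (simp add: linear_add[OF A.lin] linear_scale[OF A.lin] span_add span_scale)
qed

text \<open>The quadratic term drops out: skewness moves one \<open>\<alpha>\<close> across, and
  \<open>\<alpha> x Z (\<alpha> x c (\<sigma> x))\<close> lies in the fibre, which is orthogonal to
  \<open>dd d \<rho> x\<close>.\<close>

lemma contact_order_2':
  assumes "\<sigma> \<in> S" "\<tau> \<in> S" "x \<in> U" "wedge (\<sigma> x) (\<tau> x) \<noteq> 0" "\<rho> \<in> S"
  shows "ip (dd c \<sigma> x) (\<alpha> x Z (dd d \<rho> x)) + ip (\<sigma> x) (\<alpha> x Z (dd c (dd d \<rho>) x)) = 0"
proof -
  have "\<alpha> x Z (\<alpha> x c (\<sigma> x)) \<in> f x"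
    using \<alpha>_fibre section_mem assms by blast
  then have "ip (dd d \<rho> x) (\<alpha> x Z (\<alpha> x c (\<sigma> x))) = 0"
    using perp_field(4)[OF assms(5,3), of d] by (simp add: perp_def)
  then have "ip (\<alpha> x c (\<sigma> x)) (\<alpha> x Z (dd d \<rho> x)) = 0"
    using skew_map.skew[OF skew_\<alpha>[OF assms(3)], of "\<alpha> x c (\<sigma> x)" Z "dd d \<rho> x"]
      ip_commute[of "dd d \<rho> x"] by simp
  then show ?thesis
    using contact_order_2[OF assms(1-4) perp_field(2,4)[OF assms(5)], of c Z d] by (simp add: ip.add_left)
qed

text \<open>\<open>kills_first\<close> is fed by the order 1 conditions pairing
  \<open>\<sigma>\<close> with \<open>\<tau>\<close> along X twice, and \<open>\<sigma>\<close> with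
  itself along Y twice; the swapped frame treats \<open>\<tau>\<close>.\<close>

lemma \<alpha>_kills_fibre:
  assumes x: "x \<in> U" and v: "v \<in> f x"
  shows "\<alpha> x Z v = 0"
proof -
  obtain \<sigma> \<tau> X Y where st: "\<sigma> \<in> S" "\<tau> \<in> S" and ad: "adapted_at (f x) x \<sigma> \<tau> X Y"
    using adapted_ex[OF x] by blast
  have w: "wedge (\<sigma> x) (\<tau> x) \<noteq> 0" using ad by (simp add: adapted_at_def)
  then have w': "wedge (\<tau> x) (\<sigma> x) \<noteq> 0" by (simp add: wedge_swap[of "\<tau> x"])
  have fx: "f x = span {\<sigma> x, \<tau> x}" by (rule fibre_span[OF st x w])
  interpret A: adapted_skew "\<sigma> x" "\<tau> x" "dd X \<sigma> x" "dd Y \<sigma> x" "dd X \<tau> x" "dd Y \<tau> x"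
     "dd X (dd X \<sigma>) x" "dd X (dd Y \<sigma>) x" "dd Y (dd Y \<sigma>) x"
     "dd X (dd X \<tau>) x" "dd X (dd Y \<tau>) x" "dd Y (dd Y \<tau>) x" "\<alpha> x Z"
    by (rule adapted_skew_at[OF st x ad])
  interpret B: adapted_skew "\<tau> x" "\<sigma> x" "dd Y \<tau> x" "dd X \<tau> x" "dd Y \<sigma> x" "dd X \<sigma> x"
     "dd Y (dd Y \<tau>) x" "dd X (dd Y \<tau>) x" "dd X (dd X \<tau>) x"
     "dd Y (dd Y \<sigma>) x" "dd X (dd Y \<sigma>) x" "dd X (dd X \<sigma>) x" "\<alpha> x Z"
    by (rule A.swap_skew)
  note 2 = contact_order_2'[OF st x w] contact_order_2'[OF st(2,1) x w']
  have m: "\<alpha> x Z (\<sigma> x) \<in> span {\<sigma> x, \<tau> x}" "\<alpha> x Z (\<tau> x) \<in> span {\<sigma> x, \<tau> x}"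
    "\<alpha> x Z (\<sigma> x) \<in> span {\<tau> x, \<sigma> x}" "\<alpha> x Z (\<tau> x) \<in> span {\<tau> x, \<sigma> x}"
    using \<alpha>_fibre[OF x section_mem[OF st(1) x], of Z] \<alpha>_fibre[OF x section_mem[OF st(2) x], of Z]
    unfolding fx by (metis insert_commute)+
  have "\<alpha> x Z (\<sigma> x) = 0" "\<alpha> x Z (\<tau> x) = 0"
    by (rule A.kills_first[OF m(1) 2(1)[OF st(2)] 2(1)[OF st(1)] m(2)])
      (rule B.kills_first[OF m(4) 2(2)[OF st(1)] 2(2)[OF st(2)] m(3)])
  moreover obtain r s where "v = r *\<^sub>R \<sigma> x + s *\<^sub>R \<tau> x"
    using v fx A.mem_span by blast
  ultimately show ?thesis
    by (simp add: linear_add[OF A.lin] linear_scale[OF A.lin])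
qed

text \<open>As \<open>\<alpha>\<close> kills f at every point of U,
  \<open>dd c (\<lambda>q. G q *v \<sigma> q)\<close> equals \<open>G q *v dd c \<sigma> q\<close>
  as a function. A further derivative therefore contains no derivative of
  \<open>\<alpha>\<close>.\<close>

lemma contact_order_3':
  assumes "\<sigma> \<in> S" "\<tau> \<in> S" "x \<in> U" "wedge (\<sigma> x) (\<tau> x) \<noteq> 0" "\<rho> \<in> S"
  shows "ip (\<alpha> x b (dd c \<sigma> x) + dd b (dd c \<sigma>) x) (\<alpha> x Z (dd d \<rho> x)) +
    ip (dd c \<sigma> x) (\<alpha> x Z (dd b (dd d \<rho>) x)) + ip (dd b \<sigma> x) (\<alpha> x Z (dd c (dd d \<rho>) x)) = 0"
proof -
  have mv: "dd v (\<lambda>q. G q *v \<nu> q) y = G y *v (\<alpha> y v (\<nu> y) + dd v \<nu> y)" if "smooth_on \<nu> U" "y \<in> U" for \<nu> y v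
    using dd_matrix_vector[OF smooth_on_differentiable[OF smooth_G that(2)]
        smooth_on_differentiable[OF that]]
    by (simp add: G_\<alpha> that matrix_vector_right_distrib)
  have first: "dd v (\<lambda>q. G q *v \<sigma> q) y = G y *v dd v \<sigma> y" if "y \<in> U" for v y
    using mv[OF section_smooth[OF assms(1)] that] \<alpha>_kills_fibre[OF that section_mem[OF assms(1) that]] by simp
  have "dd b (dd c (\<lambda>q. G q *v \<sigma> q)) x = dd b (\<lambda>q. G q *v dd c \<sigma> q) x"
    using frechet_derivative_cong_open[OF open_U assms(3), of "dd c (\<lambda>q. G q *v \<sigma> q)" "\<lambda>q. G q *v dd c \<sigma> q"] first
    unfolding dd_def[of b] by simp
  also have "\<dots> = G x *v (\<alpha> x b (dd c \<sigma> x) + dd b (dd c \<sigma>) x)"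
    using mv[OF smooth_on_dd[OF section_smooth[OF assms(1)]] assms(3)] .
  finally have second: "dd b (dd c (\<lambda>q. G q *v \<sigma> q)) x = G x *v (\<alpha> x b (dd c \<sigma> x) + dd b (dd c \<sigma>) x)" .
  have "ip (\<sigma> x) (\<alpha> x Z u) = 0" for u
    using skew_map.skew[OF skew_\<alpha>[OF assms(3)], of "\<sigma> x" Z u] \<alpha>_kills_fibre[OF assms(3) section_mem[OF assms(1,3)]]
    by (simp add: ip.zero_left)
  then show ?thesis
    using contact_order_3[OF assms(1-4) perp_field(2,4)[OF assms(5)], of b c Z d]
    by (simp add: first second ip_G assms(3))
qed

lemma \<alpha>_kills_perp:
  assumes x: "x \<in> U" and v: "v \<in> perp (f x)"
  shows "\<alpha> x Z v = 0"
proof -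
  obtain \<sigma> \<tau> X Y where st: "\<sigma> \<in> S" "\<tau> \<in> S" and ad: "adapted_at (f x) x \<sigma> \<tau> X Y"
    using adapted_ex[OF x] by blast
  have w: "wedge (\<sigma> x) (\<tau> x) \<noteq> 0" using ad by (simp add: adapted_at_def)
  then have w': "wedge (\<tau> x) (\<sigma> x) \<noteq> 0" by (simp add: wedge_swap[of "\<tau> x"])
  have fx: "f x = span {\<sigma> x, \<tau> x}" by (rule fibre_span[OF st x w])
  interpret A: adapted_skew "\<sigma> x" "\<tau> x" "dd X \<sigma> x" "dd Y \<sigma> x" "dd X \<tau> x" "dd Y \<tau> x"
     "dd X (dd X \<sigma>) x" "dd X (dd Y \<sigma>) x" "dd Y (dd Y \<sigma>) x"
     "dd X (dd X \<tau>) x" "dd X (dd Y \<tau>) x" "dd Y (dd Y \<tau>) x" "\<alpha> x Z'" for Z'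
    by (rule adapted_skew_at[OF st x ad])
  interpret B: adapted_skew "\<tau> x" "\<sigma> x" "dd Y \<tau> x" "dd X \<tau> x" "dd Y \<sigma> x" "dd X \<sigma> x"
     "dd Y (dd Y \<tau>) x" "dd X (dd Y \<tau>) x" "dd X (dd X \<tau>) x"
     "dd Y (dd Y \<sigma>) x" "dd X (dd Y \<sigma>) x" "dd X (dd X \<sigma>) x" "\<alpha> x Z"
    by (rule A.swap_skew)
  have comm: "dd Y (dd X \<rho>) x = dd X (dd Y \<rho>) x" if "\<rho> \<in> S" for \<rho>
    by (rule dd_commute[OF open_U section_smooth[OF that] x])
  have k: "\<alpha> x Z' (\<sigma> x) = 0" "\<alpha> x Z' (\<tau> x) = 0" for Z'
    by (rule \<alpha>_kills_fibre[OF x section_mem[OF st(1) x]])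
      (rule \<alpha>_kills_fibre[OF x section_mem[OF st(2) x]])
  \<comment> \<open>Needed for every direction: the next identity contains \<open>\<alpha>\<close>
    along b as well as along Z.\<close>
  have im: "\<alpha> x Z' (dd Y \<sigma> x) \<in> f x" "\<alpha> x Z' (dd X \<tau> x) \<in> f x" for Z'
    using A.image_middle[OF k] contact_order_2'[OF st x w st(2), of Y Z' X] comm[OF st(2)]
    by (simp_all add: fx)
  have null: "ip u v = 0" if "u \<in> f x" "v \<in> f x" for u v
    using null_plane[OF x] that by (auto simp: null_planes_def)
  \<comment> \<open>The quadratic term pairs two vectors of the null fibre.\<close>
  have 3: "ip (dd b (dd c \<sigma>) x) (\<alpha> x Z (dd d \<rho> x)) +
      ip (dd c \<sigma> x) (\<alpha> x Z (dd b (dd d \<rho>) x)) + ip (dd b \<sigma> x) (\<alpha> x Z (dd c (dd d \<rho>) x)) = 0"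
    if "\<sigma> \<in> S" "\<tau> \<in> S" "wedge (\<sigma> x) (\<tau> x) \<noteq> 0" "\<rho> \<in> S" "\<alpha> x b (dd c \<sigma> x) \<in> f x" "\<alpha> x Z (dd d \<rho> x) \<in> f x"
    for \<sigma> \<tau> \<rho> b c d
    using contact_order_3'[OF that(1,2) x that(3,4), of b c Z d] null[OF that(5,6)]
    by (simp add: ip.add_left)
  have im': "\<alpha> x Z (dd Y \<sigma> x) \<in> span {\<sigma> x, \<tau> x}" "\<alpha> x Z (dd X \<tau> x) \<in> span {\<sigma> x, \<tau> x}"
    "\<alpha> x Z (dd X \<tau> x) \<in> span {\<tau> x, \<sigma> x}" "\<alpha> x Z (dd Y \<sigma> x) \<in> span {\<tau> x, \<sigma> x}"
    using im[of Z] unfolding fx by (simp_all only: insert_commute[of "\<tau> x" "\<sigma> x"])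
  \<comment> \<open>The two conditions differentiate \<open>\<tau>\<close> twice along X, and
    \<open>\<sigma>\<close> twice along Y, each tested on \<open>dd X \<tau>\<close>.\<close>
  have b1: "\<alpha> x Z (dd X \<tau> x) = 0"
    by (rule A.kills_middle[OF k im'(1,2) 3[OF st(2,1) w' st(2) im(2) im(2)]
          3[OF st w st(2) im(1) im(2), of Y, unfolded comm[OF st(2)]]])
  have a2: "\<alpha> x Z (dd Y \<sigma> x) = 0"
    by (rule B.kills_middle[OF k(2,1) im'(3,4) 3[OF st w st(1) im(1) im(1)]
          3[OF st(2,1) w' st(1) im(2) im(1), of X]])
  have vp: "ip v (\<sigma> x) = 0" "ip v (\<tau> x) = 0"
    using v section_mem[OF st(1) x] section_mem[OF st(2) x] unfolding perp_def by blast+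
  show ?thesis
    by (rule A.kills_perp[OF k a2 b1 vp])
qed

text \<open>The integrability condition: mixed second derivatives of \<open>G\<close> commute.\<close>

lemma \<alpha>_exchange:
  assumes x: "x \<in> U" and \<rho>: "\<rho> \<in> S"
  shows "\<alpha> x Z (dd W (dd X \<rho>) x) = \<alpha> x W (dd Z (dd X \<rho>) x)"
proof -
  have "dd W (dd Z G) x *v dd X \<rho> x + dd Z G x *v dd W (dd X \<rho>) x = 0" for W Z
  proof -
    \<comment> \<open>This holds on all of U, because first derivatives of sections lie in
      \<open>perp f\<close>, so it can be differentiated along W.\<close>
    have "dd Z G y *v dd X \<rho> y = 0" if "y \<in> U" for y
      using \<alpha>_kills_perp[OF that section_dd_perp[OF \<rho> that]] \<alpha>_eq_0_iff[OF that] by blast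
    then have "dd W (\<lambda>y. dd Z G y *v dd X \<rho> y) x = 0"
      by (intro dd_locally_const[OF open_U x])
    then show ?thesis
      using dd_matrix_vector[OF smooth_on_differentiable[OF smooth_on_dd[OF smooth_G] x]
          smooth_on_differentiable[OF smooth_on_dd[OF section_smooth[OF \<rho>]] x], of W Z X]
      by (simp add: add.commute)
  qed
  from this[of W Z] this[of Z W]
  have "dd Z G x *v dd W (dd X \<rho>) x = dd W G x *v dd Z (dd X \<rho>) x"
    unfolding dd_commute[OF open_U smooth_G x, of W Z] by (metis add_left_cancel)
  then show ?thesis by (simp add: \<alpha>_def)
qed

text \<open>Mixed second derivatives along X and Y lie in \<open>perp (f x)\<close> and are killed.
  \<open>\<alpha>_exchange\<close> turns \<alpha>_X on the pure YY derivative of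
  \<open>\<sigma>\<close> and \<alpha>_Y on the pure XX derivative of \<open>\<tau>\<close> into
  such mixed values, and \<open>kills_all\<close> applies to both.\<close>

lemma dd_G_eq_0:
  assumes x: "x \<in> U"
  shows "dd Z G x = 0"
proof -
  obtain \<sigma> \<tau> X Y where st: "\<sigma> \<in> S" "\<tau> \<in> S" and ad: "adapted_at (f x) x \<sigma> \<tau> X Y"
    using adapted_ex[OF x] by blast
  interpret A: adapted_skew "\<sigma> x" "\<tau> x" "dd X \<sigma> x" "dd Y \<sigma> x" "dd X \<tau> x" "dd Y \<tau> x"
     "dd X (dd X \<sigma>) x" "dd X (dd Y \<sigma>) x" "dd Y (dd Y \<sigma>) x"
     "dd X (dd X \<tau>) x" "dd X (dd Y \<tau>) x" "dd Y (dd Y \<tau>) x" "\<alpha> x Z'" for Z'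
    by (rule adapted_skew_at[OF st x ad])
  interpret B: adapted_skew "\<tau> x" "\<sigma> x" "dd Y \<tau> x" "dd X \<tau> x" "dd Y \<sigma> x" "dd X \<sigma> x"
     "dd Y (dd Y \<tau>) x" "dd X (dd Y \<tau>) x" "dd X (dd X \<tau>) x"
     "dd Y (dd Y \<sigma>) x" "dd X (dd Y \<sigma>) x" "dd X (dd X \<sigma>) x" "\<alpha> x Z'" for Z'
    by (rule A.swap_skew)
  have comm: "dd Y (dd X \<rho>) x = dd X (dd Y \<rho>) x" if "\<rho> \<in> S" for \<rho>
    by (rule dd_commute[OF open_U section_smooth[OF that] x])
  have k: "\<alpha> x Z' (\<rho> x) = 0" "\<alpha> x Z' (dd V \<rho> x) = 0" if "\<rho> \<in> S" for Z' \<rho> V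
    by (rule \<alpha>_kills_perp[OF x perp_field(3)[OF that x]]) (rule \<alpha>_kills_perp[OF x perp_field(4)[OF that x]])
  note kills = k(1)[OF st(1)] k(1)[OF st(2)] k(2)[OF st(1)] k(2)[OF st(2)]
  have mixed: "\<alpha> x Z' (dd X (dd Y \<sigma>) x) = 0" "\<alpha> x Z' (dd X (dd Y \<tau>) x) = 0" for Z'
    by (rule A.kills_perp[OF kills trans[OF ip_commute A.second(2)] trans[OF ip_commute A.second(8)]])
      (rule A.kills_perp[OF kills trans[OF ip_commute A.second(5)] trans[OF ip_commute A.second(11)]])
  have "\<alpha> x X (dd Y (dd Y \<sigma>) x) = 0"
    unfolding \<alpha>_exchange[OF x st(1), of X Y Y] by (rule mixed)
  then have "\<alpha> x X w = 0" for w
    by (rule A.kills_all[OF kills])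
  moreover have "\<alpha> x Y (dd X (dd X \<tau>) x) = 0"
    unfolding \<alpha>_exchange[OF x st(2), of Y X X] comm[OF st(2)] by (rule mixed)
  then have "\<alpha> x Y w = 0" for w
    by (rule B.kills_all[OF kills(2,1,4,3)])
  ultimately have "dd X G x = 0" "dd Y G x = 0"
    using \<alpha>_eq_0_iff[OF x] by (simp_all add: matrix_eq)
  moreover obtain r s where "Z = r *\<^sub>R X + s *\<^sub>R Y"
    using ad unfolding adapted_at_def by blast
  moreover have lin: "linear (\<lambda>v. dd v G x)"
    by (rule linear_dd[OF smooth_on_differentiable[OF smooth_G x]])
  ultimately show ?thesis
    by (simp add: linear_add[OF lin] linear_scale[OF lin])
qed

end

section \<open>Contact of projective lifts and null directions\<close>

lemma linear_conjugation: "linear (\<lambda>S. M ** S ** transpose M)" for M :: "real^'n^'n"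
proof (rule linearI)
  show "M ** (S + S') ** transpose M = M ** S ** transpose M + M ** S' ** transpose M" for S S'
    by (simp add: vec_eq_iff matrix_matrix_mult_def algebra_simps sum.distrib)
  show "M ** (c *\<^sub>R S) ** transpose M = c *\<^sub>R (M ** S ** transpose M)" for c S
    by (simp add: vec_eq_iff matrix_matrix_mult_def sum_distrib_left sum_distrib_right mult_ac)
qed

lemma act_span_wedge: "act M (span {wedge a b}) = span {wedge (M *v a) (M *v b)}"
  unfolding act_def by (simp add: linear_span_image[OF linear_conjugation, symmetric] act_wedge)

lemma act_act: "act M (act N l) = act (M ** N) l"
  by (simp add: act_def image_image matrix_transpose_mul matrix_mul_assoc)

lemma act_mat_1 [simp]: "act (mat 1) l = l"
  by (simp add: act_def)

lemma affine_pt_span: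
  assumes "linear \<phi>" "\<phi> s \<noteq> 0"
  shows "affine_pt \<phi> (span {s}) = inverse (\<phi> s) *\<^sub>R s"
  unfolding affine_pt_def
  using assms by (intro the_equality) (auto simp: span_singleton linear_scale field_simps)

text \<open>Interior product of a bivector with the covector dual to v.\<close>

lemma wedge_mult_flip: "wedge a b *v flip v = ip b v *\<^sub>R a - ip a v *\<^sub>R b"
proof -
  have "(wedge a b *v w) = (b \<bullet> w) *\<^sub>R a - (a \<bullet> w) *\<^sub>R b" for w
    by (simp add: vec_eq_iff wedge_def matrix_vector_mult_def inner_vec_def algebra_simps
        sum_subtractf sum_distrib_left)
  moreover have "u \<bullet> flip v = ip u v" for u
    by (metis ip_flip ip_commute inner_commute)
  ultimately show ?thesis by simp
qed

text \<open>Turns contact of projective lines into contact of vectors. The affine points of the two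
  lines differ by a function \<open>z\<close> with vanishing k-jet; the pairing is extracted from
  \<open>z\<close> by linear and bilinear operations, which lose no order.\<close>

lemma zero_jet_contact:
  fixes f :: "'a::real_normed_vector \<Rightarrow> (real^('s::finite + 't::finite)) set"
  assumes U: "open U" "x \<in> U" and G: "smooth_on G U" "\<And>y. y \<in> U \<Longrightarrow> G y \<in> Ogroup"
    and sm: "smooth_on \<sigma> U" "smooth_on \<tau> U" "smooth_on \<nu> U"
    and frame: "\<And>y. y \<in> U \<Longrightarrow> wedge (\<sigma> y) (\<tau> y) \<noteq> 0 \<Longrightarrow> f y = span {\<sigma> y, \<tau> y}"
    and wx: "wedge (\<sigma> x) (\<tau> x) \<noteq> 0"
    and \<nu>: "\<And>y. y \<in> U \<Longrightarrow> \<nu> y \<in> perp (f y)"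
    and F': "\<And>y. y \<in> U \<Longrightarrow> F' y = act (G y) (wedge2 (f y))"
    and \<phi>: "linear \<phi>" "\<exists>z\<in>wedge2 (f x). \<phi> z \<noteq> 0"
    and jet: "jet_eq k (\<lambda>y. affine_pt \<phi> (act (matrix_inv (G x)) (F' y))) (\<lambda>y. affine_pt \<phi> (wedge2 (f y))) x"
  shows "zero_jet k (\<lambda>q. ip (G q *v \<sigma> q) (G x *v \<nu> q)) x"
proof -
  let ?M = "matrix_inv (G x)"
  \<comment> \<open>A section moved by the gauge, then seen after undoing the motion at x; at x
    itself nothing has changed.\<close>
  define P where "P \<rho> q = ?M *v (G q *v \<rho> q)" for \<rho> q
  define s where "s q = wedge (\<sigma> q) (\<tau> q)" for q
  define W where "W q = wedge (P \<sigma> q) (P \<tau> q)" for q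
  note inv = matrix_inv_mult[OF Ogroup_invertible[OF G(2)[OF U(2)]]]
  have bl\<phi>: "bounded_linear \<phi>" using \<phi>(1) linear_conv_bounded_linear by blast
  have sP: "smooth_on (P \<rho>) U" if "smooth_on \<rho> U" for \<rho>
    unfolding P_def
    by (intro smooth_on_bounded_linear[OF matrix_vector_mul_bounded_linear U(1)]
        smooth_on_bilinear[OF bounded_bilinear_matrix_vector_mult U(1) G(1) that])
  have ss: "smooth_on s U"
    unfolding s_def by (rule smooth_on_bilinear[OF wedge_bilinear U(1) sm(1,2)])
  have sW: "smooth_on W U"
    unfolding W_def by (rule smooth_on_bilinear[OF wedge_bilinear U(1) sP[OF sm(1)] sP[OF sm(2)]])
  have Px: "P \<rho> x = \<rho> x" for \<rho>
    by (simp add: P_def matrix_vector_mul_assoc inv)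
  \<comment> \<open>Here both lines avoid the hyperplane at infinity of the affine chart, so their
    affine points have smooth formulas. It contains x because the two lifts coincide there.\<close>
  define V where "V = {y \<in> U. \<phi> (s y) * \<phi> (W y) \<noteq> 0}"
  have s\<phi>: "smooth_on (\<lambda>y. \<phi> (s y)) U" "smooth_on (\<lambda>y. \<phi> (W y)) U"
    by (intro smooth_on_bounded_linear[OF bl\<phi> U(1)] ss sW)+
  have "open (U \<inter> (\<lambda>y. \<phi> (s y) * \<phi> (W y)) -` (- {0}))"
    by (intro continuous_open_preimage smooth_on_continuous_on U
        smooth_on_bilinear[OF bounded_bilinear_mult U(1) s\<phi>]) auto
  then have V: "open V" "V \<subseteq> U" by (auto simp: V_def vimage_def Int_def)
  have "\<phi> (s x) \<noteq> 0"
    using \<phi> wx by (auto simp: frame[OF U(2)] wedge2_span span_singleton s_def linear_scale)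
  moreover have "W x = s x" by (simp add: W_def s_def Px)
  ultimately have xV: "x \<in> V" using U by (simp add: V_def)
  note smV = smooth_on_subset[OF _ V(2)]
  define z where "z q = inverse (\<phi> (W q)) *\<^sub>R W q - inverse (\<phi> (s q)) *\<^sub>R s q" for q
  have aff: "affine_pt \<phi> (act ?M (F' y)) = inverse (\<phi> (W y)) *\<^sub>R W y"
    "affine_pt \<phi> (wedge2 (f y)) = inverse (\<phi> (s y)) *\<^sub>R s y" if "y \<in> V" for y
  proof -
    have y: "y \<in> U" "\<phi> (s y) \<noteq> 0" "\<phi> (W y) \<noteq> 0" using that by (auto simp: V_def)
    have "s y \<noteq> 0" using y linear_0[OF \<phi>(1)] by auto
    then have w2: "wedge2 (f y) = span {s y}"
      using frame[OF y(1)] by (simp add: s_def wedge2_span)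
    then show "affine_pt \<phi> (wedge2 (f y)) = inverse (\<phi> (s y)) *\<^sub>R s y"
      using affine_pt_span \<phi>(1) y by simp
    have "act ?M (F' y) = span {W y}"
      unfolding F'[OF y(1)] w2 unfolding s_def W_def P_def by (simp add: act_span_wedge)
    then show "affine_pt \<phi> (act ?M (F' y)) = inverse (\<phi> (W y)) *\<^sub>R W y"
      using affine_pt_span \<phi>(1) y by simp
  qed
  have smI: "smooth_on (\<lambda>q. inverse (\<phi> (W q)) *\<^sub>R W q) V" "smooth_on (\<lambda>q. inverse (\<phi> (s q)) *\<^sub>R s q) V"
    by (intro smooth_on_bilinear[OF bounded_bilinear_scaleR V(1)] smooth_on_inverse V smV s\<phi> ss sW;
        simp add: V_def)+
  have jz: "zero_jet k z x"
    unfolding z_def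
    by (rule jet_eq_imp_zero_jet[OF V(1) xV smI jet_eq_cong[OF V(1) xV aff jet]])
  have sz: "smooth_on z V"
    unfolding z_def by (rule smooth_on_diff[OF V(1) smI])
  have blflip: "bounded_linear (flip :: real^('s + 't) \<Rightarrow> _)"
    using linear_flip linear_conv_bounded_linear by blast
  have sfl: "smooth_on (\<lambda>q. flip (\<nu> q)) V"
    by (intro smooth_on_bounded_linear[OF blflip V(1)] smV sm)
  have "zero_jet k (\<lambda>q. z q *v flip (\<nu> q)) x"
    by (rule zero_jet_bilinear[OF bounded_bilinear_matrix_vector_mult V(1) xV sz sfl jz])
  moreover have szv: "smooth_on (\<lambda>q. z q *v flip (\<nu> q)) V"
    by (rule smooth_on_bilinear[OF bounded_bilinear_matrix_vector_mult V(1) sz sfl])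
  ultimately have "zero_jet k (\<lambda>q. wedge (z q *v flip (\<nu> q)) (P \<sigma> q)) x"
    by (intro zero_jet_bilinear[OF wedge_bilinear V(1) xV _ smV[OF sP[OF sm(1)]]])
  then have "zero_jet k (\<lambda>q. \<phi> (wedge (z q *v flip (\<nu> q)) (P \<sigma> q))) x"
    by (intro zero_jet_bounded_linear[OF bl\<phi> V(1) xV]
        smooth_on_bilinear[OF wedge_bilinear V(1) szv smV[OF sP[OF sm(1)]]])
  then show ?thesis
  proof (rule zero_jet_cong[OF V(1) xV, rotated])
    \<comment> \<open>Contracting with \<open>\<nu>\<close> kills the multiple of \<open>s\<close> in \<open>z\<close>, and wedging with \<open>P \<sigma>\<close> then isolates the
      pairing \<open>ip (P \<sigma>) \<nu>\<close> as a multiple of \<open>W\<close>.\<close>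
    fix q assume "q \<in> V"
    then have q: "q \<in> U" "\<phi> (s q) \<noteq> 0" "\<phi> (W q) \<noteq> 0" by (auto simp: V_def)
    have "s q \<noteq> 0" using q linear_0[OF \<phi>(1)] by auto
    then have "\<nu> q \<in> perp (span {\<sigma> q, \<tau> q})"
      using \<nu>[OF q(1)] frame[OF q(1)] by (simp add: s_def)
    then have "ip (\<sigma> q) (\<nu> q) = 0" "ip (\<tau> q) (\<nu> q) = 0"
      by (auto simp: mem_perp_span ip_commute)
    then have "s q *v flip (\<nu> q) = 0"
      by (simp add: s_def wedge_mult_flip)
    then have "z q *v flip (\<nu> q) = inverse (\<phi> (W q)) *\<^sub>R (W q *v flip (\<nu> q))"
      by (simp add: z_def bounded_bilinear.diff_left[OF bounded_bilinear_matrix_vector_mult]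
          bounded_bilinear.scaleR_left[OF bounded_bilinear_matrix_vector_mult])
    also have "\<dots> = inverse (\<phi> (W q)) *\<^sub>R (ip (P \<tau> q) (\<nu> q) *\<^sub>R P \<sigma> q - ip (P \<sigma> q) (\<nu> q) *\<^sub>R P \<tau> q)"
      by (simp add: W_def wedge_mult_flip)
    finally have "wedge (z q *v flip (\<nu> q)) (P \<sigma> q) = (inverse (\<phi> (W q)) * ip (P \<sigma> q) (\<nu> q)) *\<^sub>R W q"
      by (simp add: W_def bounded_bilinear.diff_left[OF wedge_bilinear]
          bounded_bilinear.scaleR_left[OF wedge_bilinear] wedge_swap[of "P \<tau> q" "P \<sigma> q"])
    then have "\<phi> (wedge (z q *v flip (\<nu> q)) (P \<sigma> q)) = ip (P \<sigma> q) (\<nu> q)"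
      using q by (simp add: linear_scale[OF \<phi>(1)])
    also have "\<dots> = ip (G x *v P \<sigma> q) (G x *v \<nu> q)"
      by (simp add: Ogroup_ip[OF G(2)[OF U(2)]])
    also have "G x *v P \<sigma> q = G q *v \<sigma> q"
      by (simp add: P_def matrix_vector_mul_assoc matrix_mul_assoc inv)
    finally show "\<phi> (wedge (z q *v flip (\<nu> q)) (P \<sigma> q)) = ip (G q *v \<sigma> q) (G x *v \<nu> q)" .
  qed
qed

text \<open>The form factors as (a - b)(a + b), so the null directions are \<open>e1 + e2\<close>
  and \<open>e1 - e2\<close>. A vanishing determinant means a kernel vector.\<close>

lemma signature_1_1_null_directions:
  fixes w :: "2 \<Rightarrow> real^('s::finite + 't::finite)"
  assumes L: "subspace L" and dim4: "dim (perp L) = dim L + 2"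
    and span_w: "span (L \<union> range w) = perp L"
    and lin: "\<And>i. linear (\<lambda>\<xi>. D \<xi> i)"
    and mat: "\<And>\<xi>. \<exists>a :: real^2^2. (\<forall>i. D \<xi> i - (\<Sum>j\<in>UNIV. a $ j $ i *\<^sub>R w j) \<in> L) \<and> q \<xi> = det a"
    and sig: "signature_1_1 q"
  shows "\<exists>X Y. \<exists>(c :: real^2) (d :: real^2). (\<forall>Z. \<exists>r s. Z = r *\<^sub>R X + s *\<^sub>R Y) \<and>
     c $ 1 *\<^sub>R D X 1 + c $ 2 *\<^sub>R D X 2 \<in> L \<and> d $ 1 *\<^sub>R D Y 1 + d $ 2 *\<^sub>R D Y 2 \<in> L \<and>
     c $ 1 * d $ 2 - c $ 2 * d $ 1 \<noteq> 0 \<and>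
     (\<forall>r s. r *\<^sub>R D (X + Y) 1 + s *\<^sub>R D (X + Y) 2 \<in> L \<longrightarrow> r = 0 \<and> s = 0)"
proof -
  obtain e1 e2 where e: "e1 \<noteq> e2" "independent {e1, e2}"
    and q: "\<And>a b. q (a *\<^sub>R e1 + b *\<^sub>R e2) = a\<^sup>2 - b\<^sup>2"
    using sig unfolding signature_1_1_def by blast
  have "span {e1, e2} = UNIV"
    using e dim_eq_card_independent[of "{e1, e2}"] dim_eq_full[of "{e1, e2}"] by simp
  then have basis: "\<exists>r s. Z = r *\<^sub>R e1 + s *\<^sub>R e2" for Z
    using span_pair[of e1 e2] by blast
  have w_ind: "r = 0 \<and> s = 0" if rs: "r *\<^sub>R w 1 + s *\<^sub>R w 2 \<in> L" for r s
  proof (rule ccontr)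
    assume ne: "\<not> (r = 0 \<and> s = 0)"
    have range_w: "range w = {w 1, w 2}" by (simp add: UNIV_2)
    have descale: "u \<in> span A" if "k *\<^sub>R u \<in> span A" "k \<noteq> 0" for k :: real and u :: "real^('s + 't)" and A
      using span_scale[OF that(1), of "inverse k"] that(2) by simp
    have "\<exists>u u'. {u, u'} = {w 1, w 2} \<and> u \<in> span (insert u' L)"
    proof (cases "r = 0")
      case False
      have "r *\<^sub>R w 1 \<in> span (insert (w 2) L)"
        using span_diff[OF span_base span_scale[OF span_base], of "r *\<^sub>R w 1 + s *\<^sub>R w 2" "insert (w 2) L" "w 2" s] rs by simp
      then have "w 1 \<in> span (insert (w 2) L)" using False by (rule descale)
      then show ?thesis by blast
    next
      case True
      then have "s *\<^sub>R w 2 \<in> span (insert (w 1) L)" "s \<noteq> 0"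
        using rs ne by (auto intro: span_base)
      then have "w 2 \<in> span (insert (w 1) L)" by (rule descale)
      moreover have "{w 2, w 1} = {w 1, w 2}" by blast
      ultimately show ?thesis by blast
    qed
    then obtain u u' where u: "{u, u'} = {w 1, w 2}" "u \<in> span (insert u' L)" by blast
    have "L \<union> range w = insert u (insert u' L)" using u(1) range_w by auto
    then have "dim (perp L) = dim (insert u (insert u' L))"
      using span_w by (metis dim_span)
    also have "\<dots> \<le> dim L + 1"
      using u(2) by (simp add: dim_insert[of u] dim_insert[of u'])
    finally show False using dim4 by simp
  qed
  \<comment> \<open>Since the w vectors are independent modulo L, membership in L is read off from
    the matrix.\<close>
  have ker: "c $ 1 *\<^sub>R D \<xi> 1 + c $ 2 *\<^sub>R D \<xi> 2 \<in> L \<longleftrightarrow> a *v c = 0"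
    if a: "\<forall>i. D \<xi> i - (\<Sum>j\<in>UNIV. a $ j $ i *\<^sub>R w j) \<in> L" for a :: "real^2^2" and c \<xi>
  proof -
    let ?E = "\<lambda>i. D \<xi> i - (\<Sum>j\<in>UNIV. a $ j $ i *\<^sub>R w j)"
    have E: "c $ 1 *\<^sub>R ?E 1 + c $ 2 *\<^sub>R ?E 2 \<in> L"
      using a by (intro subspace_add[OF L] subspace_scale[OF L]) blast+
    have "c $ 1 *\<^sub>R D \<xi> 1 + c $ 2 *\<^sub>R D \<xi> 2 =
        (c $ 1 *\<^sub>R ?E 1 + c $ 2 *\<^sub>R ?E 2) + ((a *v c) $ 1 *\<^sub>R w 1 + (a *v c) $ 2 *\<^sub>R w 2)"
      by (simp add: sum_2 matrix_vector_mult_def algebra_simps)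
    moreover have "u + v \<in> L \<longleftrightarrow> v \<in> L" if "u \<in> L" for u v
      using subspace_add[OF L that, of v] subspace_diff[OF L _ that, of "u + v"] by auto
    ultimately have "c $ 1 *\<^sub>R D \<xi> 1 + c $ 2 *\<^sub>R D \<xi> 2 \<in> L \<longleftrightarrow> (a *v c) $ 1 *\<^sub>R w 1 + (a *v c) $ 2 *\<^sub>R w 2 \<in> L"
      using E by presburger
    also have "\<dots> \<longleftrightarrow> a *v c = 0"
      using w_ind subspace_0[OF L] by (auto simp: vec_eq_iff forall_2)
    finally show ?thesis .
  qed
  have null: "\<exists>c :: real^2. c \<noteq> 0 \<and> c $ 1 *\<^sub>R D \<xi> 1 + c $ 2 *\<^sub>R D \<xi> 2 \<in> L" if "q \<xi> = 0" for \<xi>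
  proof -
    obtain a :: "real^2^2" where a: "\<forall>i. D \<xi> i - (\<Sum>j\<in>UNIV. a $ j $ i *\<^sub>R w j) \<in> L" "q \<xi> = det a"
      using mat[of \<xi>] by (elim exE conjE)
    then have "\<not> invertible a"
      using that by (simp add: invertible_det_nz)
    then obtain c where "a *v c = 0" "c \<noteq> 0"
      by (auto simp: invertible_left_inverse matrix_left_invertible_ker)
    then show ?thesis
      using ker[OF a(1), of c] by (intro exI[of _ c]) simp
  qed
  have nonnull: "c = 0" if "q \<xi> \<noteq> 0" "c $ 1 *\<^sub>R D \<xi> 1 + c $ 2 *\<^sub>R D \<xi> 2 \<in> L" for c :: "real^2" and \<xi>
  proof -
    obtain a :: "real^2^2" where a: "\<forall>i. D \<xi> i - (\<Sum>j\<in>UNIV. a $ j $ i *\<^sub>R w j) \<in> L" "q \<xi> = det a"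
      using mat[of \<xi>] by (elim exE conjE)
    then have "invertible a"
      using that by (simp add: invertible_det_nz)
    moreover have "a *v c = 0"
      using ker[OF a(1), of c] that(2) by simp
    ultimately show ?thesis
      by (simp add: invertible_left_inverse matrix_left_invertible_ker)
  qed
  define X where "X = e1 + e2"
  define Y where "Y = e1 - e2"
  have qX: "q X = 0" using q[of 1 1] by (simp add: X_def)
  have qY: "q Y = 0" using q[of 1 "-1"] by (simp add: Y_def)
  have qXY: "q (X + Y) \<noteq> 0" using q[of 2 0] by (simp add: X_def Y_def scaleR_2)
  obtain c :: "real^2" where c: "c \<noteq> 0" "c $ 1 *\<^sub>R D X 1 + c $ 2 *\<^sub>R D X 2 \<in> L" using null[OF qX] by blast
  obtain d :: "real^2" where d: "d \<noteq> 0" "d $ 1 *\<^sub>R D Y 1 + d $ 2 *\<^sub>R D Y 2 \<in> L" using null[OF qY] by blast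
  \<comment> \<open>Proportional kernel vectors would give a common kernel along X and Y, hence
    along X + Y = 2 e1, where the form has value 4.\<close>
  have "c $ 1 * d $ 2 - c $ 2 * d $ 1 \<noteq> 0"
  proof
    assume "c $ 1 * d $ 2 - c $ 2 * d $ 1 = 0"
    then have "wedge c d = 0"
      by (simp add: wedge_def vec_eq_iff forall_2 mult.commute)
    then obtain k where k: "d = k *\<^sub>R c" using wedge_eq_0_imp c(1) by blast
    have "k \<noteq> 0" using k d(1) by auto
    then have "c $ 1 *\<^sub>R D Y 1 + c $ 2 *\<^sub>R D Y 2 = inverse k *\<^sub>R (d $ 1 *\<^sub>R D Y 1 + d $ 2 *\<^sub>R D Y 2)"
      by (simp add: k scaleR_add_right mult.assoc[symmetric])
    then have "c $ 1 *\<^sub>R D Y 1 + c $ 2 *\<^sub>R D Y 2 \<in> L" using subspace_scale[OF L d(2)] by simp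
    then have "(c $ 1 *\<^sub>R D X 1 + c $ 2 *\<^sub>R D X 2) + (c $ 1 *\<^sub>R D Y 1 + c $ 2 *\<^sub>R D Y 2) \<in> L"
      by (rule subspace_add[OF L c(2)])
    then have "c $ 1 *\<^sub>R D (X + Y) 1 + c $ 2 *\<^sub>R D (X + Y) 2 \<in> L"
      by (simp add: linear_add[OF lin] algebra_simps)
    then show False using nonnull[OF qXY] c(1) by blast
  qed
  moreover have "r = 0 \<and> s = 0" if "r *\<^sub>R D (X + Y) 1 + s *\<^sub>R D (X + Y) 2 \<in> L" for r s
    using nonnull[OF qXY, of "vector [r, s]"] that by (simp add: vec_eq_iff forall_2)
  moreover have "\<exists>r s. Z = r *\<^sub>R X + s *\<^sub>R Y" for Z
  proof -
    obtain r s where "Z = r *\<^sub>R e1 + s *\<^sub>R e2" using basis by blast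
    then have "Z = ((r + s) / 2) *\<^sub>R X + ((r - s) / 2) *\<^sub>R Y"
      by (simp add: X_def Y_def vec_eq_iff field_simps)
    then show ?thesis by blast
  qed
  ultimately show ?thesis
    using c(2) d(2) by blast
qed

section \<open>Gluing the charts\<close>

lemma sections_on_comb:
  assumes "open U" "\<And>y. y \<in> U \<Longrightarrow> subspace (f y)" "\<sigma> \<in> sections_on U f" "\<tau> \<in> sections_on U f"
  shows "(\<lambda>y. a *\<^sub>R \<sigma> y + b *\<^sub>R \<tau> y) \<in> sections_on U f"
    "x \<in> U \<Longrightarrow> dd v (\<lambda>y. a *\<^sub>R \<sigma> y + b *\<^sub>R \<tau> y) x = a *\<^sub>R dd v \<sigma> x + b *\<^sub>R dd v \<tau> x"
proof -
  have s: "smooth_on \<sigma> U" "smooth_on \<tau> U" using assms(3,4) by (auto simp: sections_on_def)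
  note sc = smooth_on_bounded_linear[OF bounded_linear_scaleR_right assms(1)]
  show dd: "dd v (\<lambda>y. a *\<^sub>R \<sigma> y + b *\<^sub>R \<tau> y) x = a *\<^sub>R dd v \<sigma> x + b *\<^sub>R dd v \<tau> x" if "x \<in> U" for v x
    using that
    by (simp add: dd_add smooth_on_differentiable[OF sc[OF s(1)]] smooth_on_differentiable[OF sc[OF s(2)]]
        dd_bounded_linear[OF bounded_linear_scaleR_right] smooth_on_differentiable[OF s(1)]
        smooth_on_differentiable[OF s(2)])
  have "smooth_on (\<lambda>y. a *\<^sub>R \<sigma> y + b *\<^sub>R \<tau> y) U"
    by (intro smooth_on_add[OF assms(1)] sc s)
  then show "(\<lambda>y. a *\<^sub>R \<sigma> y + b *\<^sub>R \<tau> y) \<in> sections_on U f"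
    using assms(2-4) by (auto simp: sections_on_def dd intro!: subspace_add subspace_scale subspace_perp)
qed

section \<open>Legendre maps on a surface, read in charts\<close>

locale legendre_surface =
  fixes T :: "'a topology" and A :: "'a chart set"
    and f :: "'a \<Rightarrow> (real^('s::finite + 't::finite)) set"
  assumes dim_total: "CARD('s) + CARD('t) = 6"
    and surface: "smooth_surface T A"
    and legendre: "legendre_map T A f"
    and signature: "p \<in> topspace T \<Longrightarrow> conf_signature_1_1 T A f p"
begin

lemma chart:
  assumes "c \<in> A"
  shows "openin T (fst c)" "fst c \<subseteq> topspace T" "open (snd c ` fst c)"
    "homeomorphic_map (subtopology T (fst c)) (top_of_set (snd c ` fst c)) (snd c)"
    "inj_on (snd c) (fst c)"
proof -
  have c: "is_chart T c" using surface assms by (auto simp: smooth_surface_def)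
  then show *: "openin T (fst c)" "open (snd c ` fst c)"
    "homeomorphic_map (subtopology T (fst c)) (top_of_set (snd c ` fst c)) (snd c)"
    by (auto simp: is_chart_def)
  then show sub: "fst c \<subseteq> topspace T" by (simp add: openin_subset)
  show "inj_on (snd c) (fst c)"
    using homeomorphic_imp_injective_map[OF *(3)] sub by (simp add: topspace_subtopology Int_absorb1)
qed

lemma chart_point:
  assumes "c \<in> A" "x \<in> snd c ` fst c"
  defines "p \<equiv> inv_into (fst c) (snd c) x"
  shows "p \<in> fst c" "snd c p = x" "p \<in> topspace T" "c \<in> charts_at A p"
  using assms chart(2)[OF assms(1)] inv_into_into[OF assms(2)] f_inv_into_f[OF assms(2)]
  by (auto simp: charts_at_def)

lemma smooth_fun_in_chart:
  assumes "smooth_fun A (topspace T) h" "c \<in> A"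
  shows "smooth_on (in_chart c h) (snd c ` fst c)"
  using assms chart(2)[OF assms(2)] by (auto simp: smooth_fun_def Int_absorb2)

lemma null_plane: "p \<in> topspace T \<Longrightarrow> f p \<in> null_planes"
  using legendre by (auto simp: legendre_map_def smooth_null_bundle_def)

lemma in_chart_section:
  assumes c: "c \<in> A" and \<sigma>: "\<sigma> \<in> sections T A f"
  shows "in_chart c \<sigma> \<in> sections_on (snd c ` fst c) (in_chart c f)"
proof -
  have "smooth_on (in_chart c \<sigma>) (snd c ` fst c)"
    using \<sigma> by (intro smooth_fun_in_chart c) (simp add: sections_def)
  moreover have "in_chart c \<sigma> x \<in> in_chart c f x" "dd v (in_chart c \<sigma>) x \<in> perp (in_chart c f x)"
    if x: "x \<in> snd c ` fst c" for x v
  proof -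
    let ?p = "inv_into (fst c) (snd c) x"
    note p = chart_point[OF c x]
    show "in_chart c \<sigma> x \<in> in_chart c f x"
      using \<sigma> p(3) by (simp add: in_chart_def sections_def)
    have "dir_deriv c \<sigma> ?p v \<in> derived T A f ?p"
      unfolding derived_def using p(4) \<sigma> by blast
    then have "dir_deriv c \<sigma> ?p v \<in> perp (f ?p)"
      using legendre p(3) unfolding legendre_map_def by blast
    then show "dd v (in_chart c \<sigma>) x \<in> perp (in_chart c f x)"
      by (simp add: dir_deriv_def dd_def p(2)) (simp add: in_chart_def)
  qed
  ultimately show ?thesis by (simp add: sections_on_def)
qed

lemma legendre_chart_in_chart:
  assumes c: "c \<in> A"
  shows "legendre_chart (snd c ` fst c) (in_chart c f)"
proof
  let ?U = "snd c ` fst c" and ?f = "in_chart c f"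
  show "open ?U" by (rule chart(3)[OF c])
  show np: "?f x \<in> null_planes" if "x \<in> ?U" for x
    using null_plane[OF chart_point(3)[OF c that]] by (simp add: in_chart_def)
  show "CARD('s) + CARD('t) = 6" by (rule dim_total)
  fix x assume x: "x \<in> ?U"
  define p where "p = inv_into (fst c) (snd c) x"
  note p = chart_point[OF c x, folded p_def]
  have fx: "?f x = f p" by (simp add: in_chart_def p_def)
  have L: "subspace (f p)" "dim (f p) = 2"
    using null_plane[OF p(3)] by (auto simp: null_planes_def)
  obtain q where "conf_rep T A f p c q" and q: "signature_1_1 q"
    using signature[OF p(3)] p(4) unfolding conf_signature_1_1_def by blast
  then obtain \<sigma> :: "2 \<Rightarrow> 'a \<Rightarrow> real^('s + 't)" and w :: "2 \<Rightarrow> real^('s + 't)"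
    where \<sigma>: "\<And>i. \<sigma> i \<in> sections T A f" and span\<sigma>: "span (range (\<lambda>i. \<sigma> i p)) = f p"
      and w: "span (f p \<union> range w) = perp (f p)"
      and a: "\<And>\<xi>. \<exists>a :: real^2^2.
           (\<forall>i. dir_deriv c (\<sigma> i) p \<xi> - (\<Sum>j\<in>UNIV. a $ j $ i *\<^sub>R w j) \<in> f p) \<and> q \<xi> = det a"
    unfolding conf_rep_def by blast
  let ?\<sigma> = "\<lambda>i. in_chart c (\<sigma> i)"
  have sec: "?\<sigma> i \<in> sections_on ?U ?f" for i by (rule in_chart_section[OF c \<sigma>])
  have D: "dir_deriv c (\<sigma> i) p \<xi> = dd \<xi> (?\<sigma> i) x" for i \<xi>
    by (simp add: dir_deriv_def dd_def p(2))
  have lin: "linear (\<lambda>\<xi>. dir_deriv c (\<sigma> i) p \<xi>)" for i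
    unfolding D
    by (rule linear_dd[OF smooth_on_differentiable[OF _ x]]) (use sec in \<open>simp add: sections_on_def\<close>)
  have dim4: "dim (perp (f p)) = dim (f p) + 2"
    using dim_perp[OF L(1)] L(2) dim_total by simp
  obtain X Y and k :: "real^2" and l :: "real^2" where basis: "\<forall>Z. \<exists>r s. Z = r *\<^sub>R X + s *\<^sub>R Y"
    and kX: "k $ 1 *\<^sub>R dd X (?\<sigma> 1) x + k $ 2 *\<^sub>R dd X (?\<sigma> 2) x \<in> f p"
    and lY: "l $ 1 *\<^sub>R dd Y (?\<sigma> 1) x + l $ 2 *\<^sub>R dd Y (?\<sigma> 2) x \<in> f p"
    and kl: "k $ 1 * l $ 2 - k $ 2 * l $ 1 \<noteq> 0"
    and inj: "\<And>r s. r *\<^sub>R dd (X + Y) (?\<sigma> 1) x + s *\<^sub>R dd (X + Y) (?\<sigma> 2) x \<in> f p \<Longrightarrow> r = 0 \<and> s = 0"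
    using signature_1_1_null_directions[OF L(1) dim4 w lin a q] unfolding D by (elim exE conjE) blast
  \<comment> \<open>Constant coefficients suffice: the combinations must be kernel vectors at the
    point x only.\<close>
  define comb where "comb k y = k $ 1 *\<^sub>R ?\<sigma> 1 y + k $ 2 *\<^sub>R ?\<sigma> 2 y" for k :: "real^2" and y
  have sub: "subspace (?f y)" if "y \<in> ?U" for y
    using np[OF that] by (simp add: null_planes_def)
  have comb: "comb k \<in> sections_on ?U ?f" "dd v (comb k) x = k $ 1 *\<^sub>R dd v (?\<sigma> 1) x + k $ 2 *\<^sub>R dd v (?\<sigma> 2) x" for k v
    unfolding comb_def[abs_def]
    by (rule sections_on_comb(1)[OF chart(3)[OF c] sub sec sec], assumption)
      (rule sections_on_comb(2)[OF chart(3)[OF c] sub sec sec x], assumption)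
  have \<sigma>x: "?\<sigma> i x = \<sigma> i p" for i by (simp add: in_chart_def p_def)
  have "f p = span {\<sigma> 1 p, \<sigma> 2 p}"
    using span\<sigma> by (simp add: UNIV_2)
  then have "wedge (\<sigma> 1 p) (\<sigma> 2 p) \<noteq> 0"
    using L(2) wedge_nonzero_iff_dim by metis
  then have "wedge (comb k x) (comb l x) \<noteq> 0"
    using kl by (simp add: comb_def wedge_comb \<sigma>x)
  moreover have "r = 0 \<and> s = 0"
    if "r *\<^sub>R dd (X + Y) (comb k) x + s *\<^sub>R dd (X + Y) (comb l) x \<in> f p" for r s
  proof -
    have "r *\<^sub>R dd (X + Y) (comb k) x + s *\<^sub>R dd (X + Y) (comb l) x =
      (r * k $ 1 + s * l $ 1) *\<^sub>R dd (X + Y) (?\<sigma> 1) x + (r * k $ 2 + s * l $ 2) *\<^sub>R dd (X + Y) (?\<sigma> 2) x"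
      by (simp add: comb algebra_simps)
    then have 0: "r * k $ 1 + s * l $ 1 = 0" "r * k $ 2 + s * l $ 2 = 0"
      using inj[of "r * k $ 1 + s * l $ 1" "r * k $ 2 + s * l $ 2"] that by simp_all
    \<comment> \<open>Cramer's rule for the two equations in r and s.\<close>
    have "r * (k $ 1 * l $ 2 - k $ 2 * l $ 1) =
        (r * k $ 1 + s * l $ 1) * l $ 2 - (r * k $ 2 + s * l $ 2) * l $ 1"
      "s * (k $ 1 * l $ 2 - k $ 2 * l $ 1) =
        (r * k $ 2 + s * l $ 2) * k $ 1 - (r * k $ 1 + s * l $ 1) * k $ 2"
      by (simp_all add: algebra_simps)
    then show ?thesis using kl unfolding 0 by simp
  qed
  ultimately have "adapted_at (?f x) x (comb k) (comb l) X Y"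
    unfolding adapted_at_def fx using basis kX lY by (simp add: comb)
  then show "\<exists>\<sigma>\<in>sections_on ?U ?f. \<exists>\<tau>\<in>sections_on ?U ?f. \<exists>X Y. adapted_at (?f x) x \<sigma> \<tau> X Y"
    using comb(1) by blast
qed

text \<open>The hypotheses of \<open>contact_chart\<close> are checked at each base point
  separately, so the affine chart of the projective space may change with the point.\<close>

lemma deformation_gauge_locally_constant:
  assumes c: "c \<in> A"
    and g: "smooth_fun A (topspace T) g" "\<And>p. p \<in> topspace T \<Longrightarrow> g p \<in> Ogroup"
    and agree: "\<And>p. p \<in> topspace T \<Longrightarrow>
      agree_to_order A 3 (\<lambda>q. act (matrix_inv (g p)) (wedge2 (f' q))) (\<lambda>q. wedge2 (f q)) p"
    and F': "\<And>p. p \<in> topspace T \<Longrightarrow> wedge2 (f' p) = act (g p) (wedge2 (f p))"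
    and x: "x \<in> snd c ` fst c"
  shows "dd Z (in_chart c g) x = 0"
proof -
  let ?U = "snd c ` fst c" and ?f = "in_chart c f" and ?G = "in_chart c g"
  interpret L: legendre_chart ?U ?f by (rule legendre_chart_in_chart[OF c])
  have GO: "?G y \<in> Ogroup" if "y \<in> ?U" for y
    using g(2)[OF chart_point(3)[OF c that]] by (simp add: in_chart_def)
  interpret contact_chart ?U ?f ?G
  proof
    show smG: "smooth_on ?G ?U" by (rule smooth_fun_in_chart[OF g(1) c])
    show "?G y \<in> Ogroup" if "y \<in> ?U" for y by (rule GO[OF that])
    fix \<sigma> \<tau> \<nu> y
    assume s: "\<sigma> \<in> sections_on ?U ?f" "\<tau> \<in> sections_on ?U ?f" and y: "y \<in> ?U"
      and w: "wedge (\<sigma> y) (\<tau> y) \<noteq> 0" and \<nu>: "smooth_on \<nu> ?U" "\<And>y. y \<in> ?U \<Longrightarrow> \<nu> y \<in> perp (?f y)"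
    define p where "p = inv_into (fst c) (snd c) y"
    note p = chart_point[OF c y, folded p_def]
    obtain \<phi> where \<phi>: "linear \<phi>" "\<exists>z\<in>wedge2 (f p). \<phi> z \<noteq> 0"
      and jet: "jet_eq 3 (in_chart c (affine_pt \<phi> \<circ> (\<lambda>q. act (matrix_inv (g p)) (wedge2 (f' q)))))
        (in_chart c (affine_pt \<phi> \<circ> (\<lambda>q. wedge2 (f q)))) (snd c p)"
      using agree[OF p(3)] p(4) unfolding agree_to_order_def by blast
    show "zero_jet 3 (\<lambda>q. ip (?G q *v \<sigma> q) (?G y *v \<nu> q)) y"
    proof (rule zero_jet_contact[OF L.open_U y smG GO L.section_smooth[OF s(1)] L.section_smooth[OF s(2)]
          \<nu>(1) L.fibre_span[OF s] w \<nu>(2) _ \<phi>(1)])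
      show "wedge2 (in_chart c f' q) = act (?G q) (wedge2 (?f q))" if "q \<in> ?U" for q
        using F'[OF chart_point(3)[OF c that]] by (simp add: in_chart_def)
      show "\<exists>z\<in>wedge2 (?f y). \<phi> z \<noteq> 0"
        using \<phi>(2) by (simp add: in_chart_def p_def)
      show "jet_eq 3 (\<lambda>q. affine_pt \<phi> (act (matrix_inv (?G y)) (wedge2 (in_chart c f' q))))
          (\<lambda>q. affine_pt \<phi> (wedge2 (?f q))) y"
        using jet unfolding p(2) by (simp add: in_chart_def p_def comp_def del: jet_eq.simps)
    qed
  qed
  show ?thesis by (rule dd_G_eq_0[OF x])
qed

end

section \<open>From local to global constancy\<close>

lemma connected_space_locally_constant:
  assumes conn: "connected_space T" and loc: "\<And>p. p \<in> topspace T \<Longrightarrow> \<exists>N. openin T N \<and> p \<in> N \<and> (\<forall>q\<in>N. g q = g p)"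
    and pq: "p \<in> topspace T" "q \<in> topspace T"
  shows "g q = g p"
proof -
  \<comment> \<open>For an arbitrary predicate, so that it covers both a level set and its
    complement.\<close>
  have op: "openin T {r \<in> topspace T. P (g r)}" for P
  proof (subst openin_subopen, intro ballI)
    fix r assume "r \<in> {r \<in> topspace T. P (g r)}"
    then have r: "r \<in> topspace T" "P (g r)" by simp_all
    from loc[OF r(1)] obtain N where N: "openin T N" "r \<in> N" "\<forall>q\<in>N. g q = g r"
      by (elim exE conjE)
    have "q \<in> topspace T \<and> P (g q)" if "q \<in> N" for q
    proof
      show "q \<in> topspace T" using openin_subset[OF N(1)] that by (rule subsetD)
      show "P (g q)" unfolding bspec[OF N(3) that] by (rule r(2))
    qed
    then have "N \<subseteq> {r \<in> topspace T. P (g r)}" by (intro subsetI CollectI)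
    with N(1,2) show "\<exists>N. openin T N \<and> r \<in> N \<and> N \<subseteq> {r \<in> topspace T. P (g r)}"
      by (intro exI[of _ N] conjI)
  qed
  define S where "S = {r \<in> topspace T. g r = g p}"
  have "openin T S"
    unfolding S_def by (rule op[of "\<lambda>v. v = g p"])
  moreover have "topspace T - S = {r \<in> topspace T. g r \<noteq> g p}"
    unfolding S_def by blast
  then have "closedin T S"
    unfolding closedin_def using op[of "\<lambda>v. v \<noteq> g p"] by (simp add: S_def)
  ultimately have "S = {} \<or> S = topspace T"
    using conn unfolding connected_space_clopen_in by blast
  moreover have "p \<in> S"
    using pq by (simp add: S_def)
  ultimately have "q \<in> S"
    using pq by blast
  then show ?thesis by (simp add: S_def)
qed

theorem theorem5p10:
  fixes T :: "'a topology" and A :: "'a chart set"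
    and f :: "'a \<Rightarrow> (real^('s::finite + 't::finite)) set"
  assumes "(CARD('s) = 3 \<and> CARD('t) = 3) \<or> (CARD('s) = 4 \<and> CARD('t) = 2)"
    and "smooth_surface T A" and "connected_space T"
    and "legendre_map T A f"
    and "\<And>p. p \<in> topspace T \<Longrightarrow> conf_signature_1_1 T A f p"
  shows "rigid_to_order T A 3 f"
proof -
  interpret legendre_surface T A f
    using assms by unfold_locales auto
  have "trivial_deformation T f f'" if def: "deformation T A 3 f f'" for f'
  proof -
    obtain g where g: "smooth_fun A (topspace T) g" "\<And>p. p \<in> topspace T \<Longrightarrow> g p \<in> Ogroup"
      and agree: "\<And>p. p \<in> topspace T \<Longrightarrow>
        agree_to_order A 3 (\<lambda>q. act (matrix_inv (g p)) (wedge2 (f' q))) (\<lambda>q. wedge2 (f q)) p"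
      using def unfolding deformation_def by blast
    \<comment> \<open>The order 0 part of the agreement, with the motion at p moved to the other
      side.\<close>
    have F': "wedge2 (f' p) = act (g p) (wedge2 (f p))" if p: "p \<in> topspace T" for p
    proof -
      have "act (g p) (act (matrix_inv (g p)) (wedge2 (f' p))) = act (g p) (wedge2 (f p))"
        using agree[OF p] by (simp add: agree_to_order_def)
      then show ?thesis
        by (simp add: act_act matrix_inv_mult Ogroup_invertible[OF g(2)[OF p]])
    qed
    have "\<exists>N. openin T N \<and> p \<in> N \<and> (\<forall>q\<in>N. g q = g p)" if p: "p \<in> topspace T" for p
    proof -
      obtain c where c: "c \<in> A" "p \<in> fst c"
        using surface p unfolding smooth_surface_def by blast
      let ?U = "snd c ` fst c"
      \<comment> \<open>A ball is convex, so a vanishing derivative makes the gauge constant on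
        it.\<close>
      obtain e where e: "e > 0" "ball (snd c p) e \<subseteq> ?U"
        using chart(3)[OF c(1)] c(2) open_contains_ball by blast
      define N where "N = {q \<in> topspace (subtopology T (fst c)). snd c q \<in> ball (snd c p) e}"
      have "openin (subtopology T (fst c)) N"
        unfolding N_def
      proof (rule openin_continuous_map_preimage)
        show "continuous_map (subtopology T (fst c)) (top_of_set ?U) (snd c)"
          by (rule homeomorphic_imp_continuous_map[OF chart(4)[OF c(1)]])
        show "openin (top_of_set ?U) (ball (snd c p) e)"
          by (rule open_subset[OF e(2) open_ball])
      qed
      then have "openin T N"
        using chart(1)[OF c(1)] openin_trans_full by blast
      moreover have "p \<in> N" using c e(1) p by (simp add: N_def)
      moreover have "g q = g p" if q: "q \<in> N" for q
      proof -
        have "in_chart c g (snd c q) = in_chart c g (snd c p)"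
        proof (rule has_derivative_zero_unique[OF convex_ball, of "snd c p" e])
          fix y assume y: "y \<in> ball (snd c p) e"
          then have yU: "y \<in> ?U" using e(2) by blast
          have "in_chart c g differentiable (at y)"
            by (rule smooth_on_differentiable[OF smooth_fun_in_chart[OF g(1) c(1)] yU])
          from dd_works[OF this] have "(in_chart c g has_derivative (\<lambda>h. 0)) (at y)"
            by (simp add: deformation_gauge_locally_constant[OF c(1) g agree F' yU])
          then show "(in_chart c g has_derivative (\<lambda>h. 0)) (at y within ball (snd c p) e)"
            by (rule has_derivative_at_withinI)
        qed (use q e(1) in \<open>auto simp: N_def\<close>)
        then show ?thesis
          using q c chart(5)[OF c(1)] by (simp add: in_chart_def N_def inv_into_f_f)
      qed
      ultimately show ?thesis by blast
    qed
    \<comment> \<open>Connectedness merges the local constants into a single matrix, the witness for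
      triviality.\<close>
    then have const: "g q = g p" if "p \<in> topspace T" "q \<in> topspace T" for p q
      using that by (rule connected_space_locally_constant[OF assms(3)])
    show ?thesis
    \<comment> \<open>On an empty surface there is no value of g to take, and the identity serves
      instead.\<close>
    proof (cases "topspace T = {}")
      case True
      have "mat 1 \<in> (Ogroup :: (real^('s + 't)^('s + 't)) set)" by (simp add: Ogroup_def)
      then show ?thesis using True by (auto simp: trivial_deformation_def)
    next
      case False
      then obtain p where p: "p \<in> topspace T" by blast
      show ?thesis
        unfolding trivial_deformation_def
        by (intro bexI[of _ "g p"] ballI g(2)[OF p]) (simp add: F' const[OF p])
    qed
  qed
  then show ?thesis unfolding rigid_to_order_def by blast
qed

end
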